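(* Suppose the following hold. (Disutilities) For each $i\in\{1,\dots,n\}$, the function $f_i:\mathbb{R}\to\mathbb{R}$ is convex with a (not necessarily unique) minimum at $0$; it is coercive, i.e. $\{x\in\mathbb{R} : f_i(x)\le F\}$ is compact for every $F\ge 0$; it is continuously differentiable; and its derivative $\nabla f_i$ is Lipschitz. (Geometry) The domain $\Omega=\Omega_1\times\dots\times\Omega_n$ is compact, the graph $\mathcal{G}$ is connected, and the disturbance $\bar g\in\mathbb{R}$ is a constant. (Technical) $c>0$ is a constant. Suppose further that the optimization problem $$\min_{x_1,\dots,x_n}\ \sum_{i=1}^n f_i(x_i)\quad\text{subject to}\quad \sum_{i=1}^n x_i=\bar g,\qquad x_i\in\Omega_i\ (i=1,\dots,n)$$ has a solution, and that all of its solutions are strictly feasible, i.e. lie in the interior of $\Omega$. Let $X^*$ be its set of solutions. Then $X^*$ is globally asymptotically stable (on $\Omega$) for the projected ordinary differential equation $$\dot{\boldsymbol{x}}(t)=\Gamma_{\Omega,\boldsymbol{x}(t)}\big[-cL\nabla f(\boldsymbol{x}(t))^T+u(t)\boldsymbol{1}\big],\qquad u(t)=\bar g-\boldsymbol{1}^T\boldsymbol{x}(t).$$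
   Context: $\Omega_i=[\underline{x}_i,\bar x_i]\subset\mathbb{R}$ are intervals, $i=1,\dots,n$. $\mathcal{G}=(\mathcal{V},\mathcal{E})$ is an undirected graph on $\mathcal{V}=\{1,\dots,n\}$, with neighbor sets $\mathcal{N}_i=\{j:(i,j)\in\mathcal{E}\}$. $L\in\mathbb{R}^{n\times n}$ is its graph Laplacian: $L_{ii}=|\mathcal{N}_i|$, and for $j\ne i$, $L_{ij}=-1$ if $j\in\mathcal{N}_i$ and $L_{ij}=0$ otherwise. $f(\boldsymbol{x})=\sum_{i=1}^n f_i(x_i)$, $\nabla f(\boldsymbol{x})$ is its gradient (a row vector), $\nabla f_i$ is the derivative of $f_i$, and $\boldsymbol{1}\in\mathbb{R}^n$ is the all-ones vector. For $\boldsymbol{y}\in\Omega$ and $\boldsymbol{z}\in\mathbb{R}^n$, $\Gamma_{\Omega,\boldsymbol{y}}[\boldsymbol{z}]\in\mathbb{R}^n$ is the vector whose $i$-th component is $0$ if $y_i=\min\Omega_i$ and $z_i<0$; $0$ if $y_i=\max\Omega_i$ and $z_i>0$; and $z_i$ otherwise. Solutions of the differential equation are understood in the Caratheodory sense: absolutely continuous functions $\boldsymbol{x}:[0,\infty)\to\Omega$ satisfying the equation for almost every $t$. (For each $\boldsymbol{x}(0)\in\Omega$ there is a unique such solution.) Global asymptotic stability of the set $X^*$ (in the sense of Khalil, Nonlinear Systems) means: (stability) for every $\varepsilon>0$ there is $\delta>0$ such that $\boldsymbol{x}(0)\in\Omega$ and $\mathrm{dist}(\boldsymbol{x}(0),X^*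 )<\delta$ imply $\mathrm{dist}(\boldsymbol{x}(t),X^* )<\varepsilon$ for all $t\ge0$; and (global attractiveness) $\mathrm{dist}(\boldsymbol{x}(t),X^* )\to0$ as $t\to\infty$ for every $\boldsymbol{x}(0)\in\Omega$. *)

theory Defs
  imports "Graph_Theory.Digraph_Component" "HOL-Analysis.Analysis"
begin

text \<open>
  Vectors in $n$-dimensional space are elements of \<^typ>\<open>real ^ 'n\<close>, and the vertex set is
  \<^term>\<open>UNIV :: 'n set\<close>. As in the \<open>Graph_Theory\<close> entry, an undirected graph is an irreflexive
  symmetric digraph, so each edge occurs in both orientations.
\<close>

definition neighbors :: "'n pair_pre_digraph \<Rightarrow> 'n \<Rightarrow> 'n set" where
  "neighbors G i = {j. (i, j) \<in> parcs G}"

definition laplacian :: "'n::finite pair_pre_digraph \<Rightarrow> real ^ 'n ^ 'n" where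
  "laplacian G = (\<chi> i j. if i = j then real (card (neighbors G i))
                         else if j \<in> neighbors G i then - 1 else 0)"

definition gradient :: "('a::real_inner \<Rightarrow> real) \<Rightarrow> 'a \<Rightarrow> 'a" where
  "gradient F x = (THE D. GDERIV F x :> D)"

definition Omega :: "real ^ 'n \<Rightarrow> real ^ 'n \<Rightarrow> (real ^ 'n) set" where
  "Omega lo hi = {x. \<forall>i. x $ i \<in> {lo $ i .. hi $ i}}"

definition total_cost :: "('n::finite \<Rightarrow> real \<Rightarrow> real) \<Rightarrow> real ^ 'n \<Rightarrow> real" where
  "total_cost f x = (\<Sum>i\<in>UNIV. f i (x $ i))"

definition feasible :: "real ^ 'n \<Rightarrow> real ^ 'n \<Rightarrow> real \<Rightarrow> (real ^ 'n::finite) set" where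
  "feasible lo hi g = {x \<in> Omega lo hi. (\<Sum>i\<in>UNIV. x $ i) = g}"

definition optimizers ::
  "('n::finite \<Rightarrow> real \<Rightarrow> real) \<Rightarrow> real ^ 'n \<Rightarrow> real ^ 'n \<Rightarrow> real \<Rightarrow> (real ^ 'n) set" where
  "optimizers f lo hi g =
     {x \<in> feasible lo hi g. \<forall>y \<in> feasible lo hi g. total_cost f x \<le> total_cost f y}"

text \<open>The projection operator at a point \<open>y\<close> of the box with lower and upper corners
  \<open>lo\<close> and \<open>hi\<close>.\<close>

definition Gamma :: "real ^ 'n \<Rightarrow> real ^ 'n \<Rightarrow> real ^ 'n \<Rightarrow> real ^ 'n \<Rightarrow> real ^ 'n::finite" where
  "Gamma lo hi y z =
     (\<chi> i. if y $ i = lo $ i \<and> z $ i < 0 then 0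
           else if y $ i = hi $ i \<and> z $ i > 0 then 0
           else z $ i)"

text \<open>
  The usual \<open>\<epsilon>\<close>-\<open>\<delta>\<close> notion of absolute continuity: a finite family of non-overlapping compact
  intervals contained in \<open>S\<close> is a set \<open>D\<close> with \<^term>\<open>D division_of \<Union>D\<close>, and each
  interval \<open>K\<close> in \<open>D\<close> has end points \<^term>\<open>Inf K\<close> and \<^term>\<open>Sup K\<close>. (The library constant
  \<^const>\<open>absolutely_continuous\<close> concerns measures.)
\<close>

definition absolutely_continuous_on :: "real set \<Rightarrow> (real \<Rightarrow> 'a::metric_space) \<Rightarrow> bool" where
  "absolutely_continuous_on S x \<longleftrightarrow>
     (\<forall>\<epsilon>>0. \<exists>\<delta>>0. \<forall>D. D division_of \<Union>D \<and> \<Union>D \<subseteq> S \<and> (\<Sum>K\<in>D. Sup K - Inf K) < \<delta>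
        \<longrightarrow> (\<Sum>K\<in>D. dist (x (Inf K)) (x (Sup K))) < \<epsilon>)"

text \<open>
  Caratheodory solutions on the half line of the autonomous equation \<open>x' = \<Phi> x\<close> that remain
  in \<open>S\<close>. As usual on an unbounded time domain, absolute continuity is required on every compact
  interval \<open>[0, T]\<close>.
\<close>

definition caratheodory_solution ::
  "('a::real_normed_vector \<Rightarrow> 'a) \<Rightarrow> 'a set \<Rightarrow> (real \<Rightarrow> 'a) \<Rightarrow> bool" where
  "caratheodory_solution \<Phi> S x \<longleftrightarrow>
     (\<forall>T\<ge>0. absolutely_continuous_on {0..T} x) \<and>
     (\<forall>t\<ge>0. x t \<in> S) \<and>
     (AE t in lebesgue. t \<ge> 0 \<longrightarrow> (x has_vector_derivative \<Phi> (x t)) (at t within {0..}))"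

definition globally_asymptotically_stable ::
  "('a::real_normed_vector \<Rightarrow> 'a) \<Rightarrow> 'a set \<Rightarrow> 'a set \<Rightarrow> bool" where
  "globally_asymptotically_stable \<Phi> S X \<longleftrightarrow>
     (\<forall>\<epsilon>>0. \<exists>\<delta>>0. \<forall>x. caratheodory_solution \<Phi> S x \<and> x 0 \<in> S \<and> infdist (x 0) X < \<delta>
        \<longrightarrow> (\<forall>t\<ge>0. infdist (x t) X < \<epsilon>)) \<and>
     (\<forall>x. caratheodory_solution \<Phi> S x \<and> x 0 \<in> S
        \<longrightarrow> ((\<lambda>t. infdist (x t) X) \<longlongrightarrow> 0) at_top)"

definition dynamics ::
  "('n::finite \<Rightarrow> real \<Rightarrow> real) \<Rightarrow> real ^ 'n \<Rightarrow> real ^ 'n \<Rightarrow> 'n pair_pre_digraph \<Rightarrow> real \<Rightarrow> real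
     \<Rightarrow> real ^ 'n \<Rightarrow> real ^ 'n" where
  "dynamics f lo hi G c g x =
     (let u = g - (\<Sum>i\<in>UNIV. x $ i)
      in Gamma lo hi x (- c *\<^sub>R (laplacian G *v gradient (total_cost f) x) + u *\<^sub>R 1))"

end

theory Submission
  imports Defs
begin

text \<open>
  Fix a solution \<open>x*\<close> of the optimization problem. Being interior, it satisfies
  \<open>f\<^sub>i'(x*\<^sub>i) = \<mu>\<close> for all \<open>i\<close>. Let \<open>s = x - x*\<close>, and let \<open>s\<^sup>+\<close> and \<open>s\<^sup>-\<close> be the sums of the positive
  and negative parts of its components, so that \<open>u = s\<^sup>- - s\<^sup>+\<close>. While \<open>u \<ge> 0\<close>, the coordinates below
  \<open>x*\<close> have derivatives at most \<open>\<mu>\<close> and the others at least \<open>\<mu>\<close>, so the consensus term only moves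
  mass into the former and \<open>s\<^sup>-\<close> decreases at rate at least \<open>u\<close>; symmetrically for \<open>u \<le> 0\<close>. Hence
  \<open>W = max s\<^sup>+ s\<^sup>-\<close> decreases at rate at least \<open>\<bar>u\<bar>\<close>, and it is equivalent to the distance to \<open>x*\<close>,
  which gives stability. The projection only helps, because \<open>x*\<close> is interior.

  For attractivity, \<open>V = \<Sum>\<^sub>i (f\<^sub>i(x\<^sub>i) - \<mu> x\<^sub>i)\<close> satisfies \<open>V' \<le> - c D + B \<bar>u\<bar>\<close>, where \<open>D\<close> is the
  Laplacian quadratic form of the derivatives. So \<open>V + (B + 1) W\<close> decreases at rate at least
  \<open>c D + \<bar>u\<bar>\<close>, which therefore tends to \<open>0\<close> along solutions; on the box it vanishes exactly at the
  optimizers.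
\<close>

section \<open>Absolutely continuous functions with bounded rate\<close>

lemma absolutely_continuous_on_subset:
  assumes "absolutely_continuous_on S x" "T \<subseteq> S"
  shows "absolutely_continuous_on T x"
  using assms unfolding absolutely_continuous_on_def by (meson subset_trans)

lemma absolutely_continuous_on_lipschitz_compose:
  fixes x :: "real \<Rightarrow> 'a::metric_space" and F :: "'a \<Rightarrow> 'b::metric_space"
  assumes x: "absolutely_continuous_on S x" and F: "L-lipschitz_on X F" and "x ` S \<subseteq> X"
  shows "absolutely_continuous_on S (\<lambda>t. F (x t))"
  unfolding absolutely_continuous_on_def
proof (intro allI impI)
  fix e :: real assume "e > 0"
  have L: "L \<ge> 0" using F by (rule lipschitz_on_nonneg)
  \<comment> \<open>Dividing by \<open>L + 1\<close> rather than \<open>L\<close> covers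
    \<open>L = 0\<close>.\<close>
  have "e / (L + 1) > 0" using \<open>e > 0\<close> L by simp
  with x obtain d where "d > 0" and d: "\<And>D. D division_of \<Union>D \<Longrightarrow> \<Union>D \<subseteq> S \<Longrightarrow>
      (\<Sum>K\<in>D. Sup K - Inf K) < d \<Longrightarrow> (\<Sum>K\<in>D. dist (x (Inf K)) (x (Sup K))) < e / (L + 1)"
    unfolding absolutely_continuous_on_def by meson
  have "(\<Sum>K\<in>D. dist (F (x (Inf K))) (F (x (Sup K)))) < e"
    if D: "D division_of \<Union>D" "\<Union>D \<subseteq> S" "(\<Sum>K\<in>D. Sup K - Inf K) < d" for D
  proof -
    have "dist (F (x (Inf K))) (F (x (Sup K))) \<le> (L + 1) * dist (x (Inf K)) (x (Sup K))"
      if "K \<in> D" for K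
    proof -
      obtain a b where K: "K = cbox a b" "K \<noteq> {}"
        using division_ofD(3,4)[OF D(1) \<open>K \<in> D\<close>] by blast
      moreover have "K \<subseteq> S" using D(2) \<open>K \<in> D\<close> by blast
      ultimately have "Inf K \<in> S" "Sup K \<in> S" by auto
      then have "dist (F (x (Inf K))) (F (x (Sup K))) \<le> L * dist (x (Inf K)) (x (Sup K))"
        using F assms(3) by (auto intro!: lipschitz_onD)
      also have "\<dots> \<le> (L + 1) * dist (x (Inf K)) (x (Sup K))"
        by (simp add: mult_right_mono)
      finally show ?thesis .
    qed
    then have "(\<Sum>K\<in>D. dist (F (x (Inf K))) (F (x (Sup K))))
        \<le> (L + 1) * (\<Sum>K\<in>D. dist (x (Inf K)) (x (Sup K)))"
      unfolding sum_distrib_left by (rule sum_mono)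
    also have "\<dots> < (L + 1) * (e / (L + 1))"
      using d[OF D] L by (intro mult_strict_left_mono) auto
    finally show ?thesis using L by simp
  qed
  then show "\<exists>d>0. \<forall>D. D division_of \<Union>D \<and> \<Union>D \<subseteq> S \<and> (\<Sum>K\<in>D. Sup K - Inf K) < d \<longrightarrow>
      (\<Sum>K\<in>D. dist (F (x (Inf K))) (F (x (Sup K)))) < e"
    using \<open>d > 0\<close> by blast
qed

text \<open>Increments across \<open>t\<close> are what tagged intervals see. For a maximum of differentiable
  functions this bound holds at a kink as soon as the derivatives of the active functions obey it,
  whereas two-sided differentiability fails there.\<close>

definition straddle_rate_le :: "real set \<Rightarrow> (real \<Rightarrow> real) \<Rightarrow> real \<Rightarrow> real \<Rightarrow> bool" where
  "straddle_rate_le S w t r \<longleftrightarrow>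
     (\<forall>e>0. \<exists>d>0. \<forall>u\<in>S. \<forall>v\<in>S. u \<le> t \<and> t \<le> v \<and> t - d < u \<and> v < t + d
        \<longrightarrow> w v - w u \<le> (r + e) * (v - u))"

lemma straddle_rate_le_mono:
  assumes "straddle_rate_le S w t r" "r \<le> r'"
  shows "straddle_rate_le S w t r'"
proof -
  have "(r + e) * (v - u) \<le> (r' + e) * (v - u)" if "u \<le> v" for u v e
    using that assms(2) by (intro mult_right_mono) auto
  then show ?thesis
    using assms(1) unfolding straddle_rate_le_def by (meson order_trans)
qed

text \<open>A Cousin-type argument: tags outside the null set contribute at most the rate, the remaining
  tagged intervals lie in an open set of small measure and are controlled by absolute
  continuity.\<close>

lemma absolutely_continuous_on_increment_le:
  fixes w :: "real \<Rightarrow> real"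
  assumes ac: "absolutely_continuous_on {a..b} w" and ab: "a \<le> b"
    and N: "negligible N"
    and rate: "\<And>t. t \<in> {a..b} - N \<Longrightarrow> straddle_rate_le {a..b} w t r"
  shows "w b - w a \<le> r * (b - a)"
proof (rule field_le_epsilon)
  fix e :: real assume e: "e > 0"
  \<comment> \<open>The error \<open>e\<close> is split into \<open>e / 2\<close> for the excess
    \<open>e'\<close> of the rate over the whole interval, \<open>e / 4\<close> for the increments
    over the intervals tagged in \<open>N\<close>, and \<open>e / 4\<close> for the length that
    these intervals take away. The \<open>+ 1\<close> covers \<open>a = b\<close>.\<close>
  define e' where "e' = e / (2 * (b - a + 1))"
  have e': "e' > 0" and e'': "e' * (b - a) \<le> e / 2"
    using e ab unfolding e'_def by (auto simp: field_simps)
  have "e / 4 > 0" using e by simp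
  with ac obtain d0 where "d0 > 0" and d0: "\<And>D. D division_of \<Union>D \<Longrightarrow> \<Union>D \<subseteq> {a..b} \<Longrightarrow>
      (\<Sum>K\<in>D. Sup K - Inf K) < d0 \<Longrightarrow> (\<Sum>K\<in>D. dist (w (Inf K)) (w (Sup K))) < e / 4"
    unfolding absolutely_continuous_on_def by meson
  \<comment> \<open>A total length below \<open>d1\<close> both triggers absolute continuity and
    makes \<open>\<bar>r\<bar>\<close> times that length at most \<open>e / 4\<close>.\<close>
  define d1 where "d1 = min d0 (e / (4 * (\<bar>r\<bar> + 1)))"
  have d1: "d1 > 0" using \<open>d0 > 0\<close> e unfolding d1_def by (simp add: add_pos_nonneg)
  have "N \<in> sets lebesgue" using N negligible_imp_sets by blast
  then obtain U where U: "open U" "N \<subseteq> U" "U - N \<in> lmeasurable" "emeasure lebesgue (U - N) < ennreal d1"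
    using sets_lebesgue_outer_open d1 by metis
  have nN: "N \<in> null_sets lebesgue" using N negligible_iff_null_sets by blast
  have U_sets: "U \<in> sets lebesgue" using U(1) by simp
  have "emeasure lebesgue (U - N) = emeasure lebesgue U"
    using nN U_sets by (rule emeasure_Diff_null_set)
  with U(4) have emU: "emeasure lebesgue U < ennreal d1" by simp
  have Um: "U \<in> lmeasurable"
    using U_sets less_trans[OF emU ennreal_less_top] by (simp add: fmeasurable_def)
  have mU: "measure lebesgue U < d1"
    using emU emeasure_eq_measure2[OF Um] by (simp add: ennreal_less_iff)
  \<comment> \<open>This is the radius of the gauge: at a tag in \<open>N\<close> the ball stays in
    the small open set \<open>U\<close>; at any other tag of \<open>{a..b}\<close> the rate bound
    holds with error \<open>e'\<close>.\<close>
  have "\<exists>d>0. (t \<in> N \<longrightarrow> ball t d \<subseteq> U) \<and>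
     (t \<in> {a..b} - N \<longrightarrow> (\<forall>u\<in>{a..b}. \<forall>v\<in>{a..b}. u \<le> t \<and> t \<le> v \<and> t - d < u \<and> v < t + d \<longrightarrow>
        w v - w u \<le> (r + e') * (v - u)))" for t
  proof (cases "t \<in> N")
    case True
    then show ?thesis using U(1,2) open_contains_ball by blast
  next
    case False
    then show ?thesis
      using rate[of t] e' unfolding straddle_rate_le_def by (cases "t \<in> {a..b}") (auto intro: exI[of _ 1])
  qed
  then obtain \<rho> where \<rho>: "\<And>t. \<rho> t > 0" "\<And>t. t \<in> N \<Longrightarrow> ball t (\<rho> t) \<subseteq> U"
     "\<And>t u v. t \<in> {a..b} - N \<Longrightarrow> u\<in>{a..b} \<Longrightarrow> v\<in>{a..b} \<Longrightarrow> u \<le> t \<Longrightarrow> t \<le> v \<Longrightarrow>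
        t - \<rho> t < u \<Longrightarrow> v < t + \<rho> t \<Longrightarrow> w v - w u \<le> (r + e') * (v - u)"
    by metis
  have "gauge (\<lambda>t. ball t (\<rho> t))" using \<rho>(1) by (auto intro: gauge_ball_dependent)
  then obtain p where p: "p tagged_division_of {a..b}" and fine: "(\<lambda>t. ball t (\<rho> t)) fine p"
    by (rule fine_division_exists_real)
  have fin: "finite p" using p by blast
  define B where "B = {q \<in> p. fst q \<in> N}"
  have "B \<subseteq> p" unfolding B_def by auto
  let ?D = "snd ` B"
  have Bp: "B tagged_partial_division_of {a..b}"
    using tagged_partial_division_subset p \<open>B \<subseteq> p\<close> unfolding tagged_division_of_def by blast
  have D: "?D division_of \<Union>?D" using partial_division_of_tagged_division[OF Bp] .
  have sub: "\<Union>?D \<subseteq> {a..b}" using Bp unfolding tagged_partial_division_of_def by force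
  have subU: "\<Union>?D \<subseteq> U"
    using fine \<rho>(2) unfolding B_def fine_def by fastforce
  have mem: "\<exists>u v. K = {u..v} \<and> u \<le> t \<and> t \<le> v \<and> u \<in> {a..b} \<and> v \<in> {a..b} \<and> Inf K = u \<and> Sup K = v \<and>
      t - \<rho> t < u \<and> v < t + \<rho> t \<and> t \<in> {a..b}" if tK: "(t, K) \<in> p" for t K
  proof -
    obtain u v where K: "K = cbox u v" using p tK by blast
    have tK': "t \<in> K" "K \<subseteq> {a..b}" "K \<subseteq> ball t (\<rho> t)"
      using p tK fine unfolding fine_def by (blast, blast, blast)
    then have uv: "u \<le> t" "t \<le> v" "u \<in> K" "v \<in> K" unfolding K by auto
    then have "u \<in> ball t (\<rho> t)" "v \<in> ball t (\<rho> t)" using tK' by auto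
    then have "t - \<rho> t < u" "v < t + \<rho> t" unfolding ball_def dist_real_def by auto
    then show ?thesis using uv tK' unfolding K by auto
  qed
  have len: "(\<Sum>K\<in>?D. Sup K - Inf K) < d1"
  proof -
    have "(\<Sum>K\<in>?D. Sup K - Inf K) = sum (measure lebesgue) ?D"
    proof (rule sum.cong[OF refl])
      fix K assume "K \<in> ?D"
      then obtain t where "(t, K) \<in> p" using \<open>B \<subseteq> p\<close> by auto
      then obtain u v where "K = {u..v}" "u \<le> v" using mem by (meson order_trans)
      then show "Sup K - Inf K = measure lebesgue K" by simp
    qed
    also have "\<dots> = measure lebesgue (\<Union>?D)"
      using content_division[OF D] by simp
    also have "\<dots> \<le> measure lebesgue U"
      using subU Um D by (intro measure_mono_fmeasurable) (meson fmeasurableD lmeasurable_division)+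
    finally show ?thesis using mU by simp
  qed
  have Bt: "B tagged_division_of \<Union>?D" using tagged_partial_division_of_Union_self[OF Bp] .
  have over: "(\<Sum>(t, K)\<in>B. h K) = (\<Sum>K\<in>?D. h K)" if h: "\<And>u. h {u} = 0" for h :: "real set \<Rightarrow> real"
  proof -
    \<comment> \<open>\<open>Inf\<close> and \<open>Sup\<close> of the empty interval carry no
      information, so \<open>?h\<close> forces the value 0 there; no interval of \<open>B\<close> is
      empty.\<close>
    let ?h = "\<lambda>K. if K = {} then 0 else h K"
    have ne: "K \<noteq> {}" if "(t, K) \<in> B" for t K using mem that \<open>B \<subseteq> p\<close> by fastforce
    have "(\<Sum>(t, K)\<in>B. h K) = (\<Sum>(t, K)\<in>B. ?h K)" using ne by (intro sum.cong) auto
    also have "\<dots> = (\<Sum>K\<in>?D. ?h K)"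
    proof (rule sum.over_tagged_division_lemma[OF Bt])
      fix u v :: real assume "box u v = {}"
      then show "?h (cbox u v) = 0" using h by (cases "u = v") auto
    qed
    also have "\<dots> = (\<Sum>K\<in>?D. h K)" using ne by (intro sum.cong) auto
    finally show ?thesis .
  qed
  have len_p: "(\<Sum>(t, K)\<in>B. Sup K - Inf K) = (\<Sum>K\<in>?D. Sup K - Inf K)"
    by (rule over) simp
  have dist_p: "(\<Sum>(t, K)\<in>B. dist (w (Inf K)) (w (Sup K))) = (\<Sum>K\<in>?D. dist (w (Inf K)) (w (Sup K)))"
    by (rule over) simp
  let ?len = "\<Sum>(t, K)\<in>B. Sup K - Inf K"
  have len0: "?len \<ge> 0"
    using mem \<open>B \<subseteq> p\<close> by (intro sum_nonneg) fastforce
  have bad: "(\<Sum>(t, K)\<in>B. w (Sup K) - w (Inf K)) \<le> e / 4"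
  proof -
    have "(\<Sum>(t, K)\<in>B. w (Sup K) - w (Inf K)) \<le> (\<Sum>(t, K)\<in>B. dist (w (Inf K)) (w (Sup K)))"
      by (intro sum_mono) (auto simp: dist_real_def)
    also have "\<dots> < e / 4"
      unfolding dist_p using len d1_def by (intro d0 D sub) auto
    finally show ?thesis by simp
  qed
  have good: "(\<Sum>(t, K)\<in>p - B. w (Sup K) - w (Inf K)) \<le> (r + e') * (\<Sum>(t, K)\<in>p - B. Sup K - Inf K)"
    unfolding sum_distrib_left
  proof (rule sum_mono)
    fix q assume q: "q \<in> p - B"
    obtain t K where [simp]: "q = (t, K)" by (cases q)
    have "t \<notin> N" "(t, K) \<in> p" using q unfolding B_def by auto
    then show "(case q of (t, K) \<Rightarrow> w (Sup K) - w (Inf K))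
        \<le> (r + e') * (case q of (t, K) \<Rightarrow> Sup K - Inf K)"
      using mem[of t K] \<rho>(3)[of t "Inf K" "Sup K"] by auto
  qed
  have "w b - w a = (\<Sum>(t, K)\<in>p. w (Sup K) - w (Inf K))"
    using additive_tagged_division_1[OF ab p, of w] by simp
  also have "\<dots> = (\<Sum>(t, K)\<in>p - B. w (Sup K) - w (Inf K)) + (\<Sum>(t, K)\<in>B. w (Sup K) - w (Inf K))"
    using sum.subset_diff[OF \<open>B \<subseteq> p\<close> fin] by blast
  also have "\<dots> \<le> (r + e') * (\<Sum>(t, K)\<in>p - B. Sup K - Inf K) + e / 4"
    using good bad by linarith
  also have "(\<Sum>(t, K)\<in>p - B. Sup K - Inf K) = (b - a) - ?len"
    using additive_tagged_division_1[OF ab p, of "\<lambda>x. x"]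
      sum.subset_diff[OF \<open>B \<subseteq> p\<close> fin, of "\<lambda>(t, K). Sup K - Inf K"] by simp
  \<comment> \<open>As \<open>r\<close> may be negative, taking away the length \<open>?len\<close>
    can raise the bound; the choice of \<open>d1\<close> limits this to
    \<open>e / 4\<close>.\<close>
  also have "(r + e') * ((b - a) - ?len) + e / 4 \<le> r * (b - a) + e"
  proof -
    have "\<bar>r\<bar> * ?len \<le> (\<bar>r\<bar> + 1) * d1"
      using len len_p len0 by (intro mult_mono) auto
    also have "\<dots> \<le> (\<bar>r\<bar> + 1) * (e / (4 * (\<bar>r\<bar> + 1)))"
      unfolding d1_def by (intro mult_left_mono) auto
    also have "\<dots> = e / 4" by (simp add: field_simps add_nonneg_eq_0_iff)
    finally have "- (r * ?len) \<le> e / 4"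
      using len0 by (smt (verit) mult_minus_left mult_right_mono)
    moreover have "e' * ?len \<ge> 0" using e' len0 by simp
    ultimately show ?thesis using e'' by (simp add: algebra_simps)
  qed
  finally show "w b - w a \<le> r * (b - a) + e" .
qed

text \<open>The increment is split at \<open>t\<close>. To the right all branches count: the active
  ones are controlled by their derivatives, the others by continuity, as they start strictly below
  the maximum. To the left a single active branch suffices, since the maximum lies above it.\<close>

lemma straddle_rate_le_Max:
  fixes \<phi> :: "'k \<Rightarrow> real \<Rightarrow> real"
  assumes I: "finite I" "I \<noteq> {}" and t: "t \<in> S"
    and der: "\<And>k. k \<in> I \<Longrightarrow> (\<phi> k has_real_derivative D k) (at t within S)"
    and active: "\<And>k. k \<in> I \<Longrightarrow> \<phi> k t = Max ((\<lambda>k. \<phi> k t) ` I) \<Longrightarrow> D k \<le> r"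
  shows "straddle_rate_le S (\<lambda>s. Max ((\<lambda>k. \<phi> k s) ` I)) t r"
  unfolding straddle_rate_le_def
proof (intro allI impI)
  fix e :: real assume e: "e > 0"
  define w where "w = (\<lambda>s. Max ((\<lambda>k. \<phi> k s) ` I))"
  have w_ge: "\<phi> k s \<le> w s" if "k \<in> I" for k s
    using I that unfolding w_def by simp
  have "w t \<in> (\<lambda>k. \<phi> k t) ` I" unfolding w_def using I by (intro Max_in) auto
  then obtain k0 where k0: "k0 \<in> I" "\<phi> k0 t = w t" by auto
  have approx: "\<exists>d>0. \<forall>s\<in>S. \<bar>s - t\<bar> < d \<longrightarrow> \<bar>\<phi> k s - \<phi> k t - D k * (s - t)\<bar> \<le> e * \<bar>s - t\<bar>"
    if "k \<in> I" for k
    using der[OF that] e unfolding has_field_derivative_def has_derivative_within_alt by auto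
  have right: "\<exists>d>0. \<forall>s\<in>S. t \<le> s \<and> s < t + d \<longrightarrow> \<phi> k s \<le> w t + (r + e) * (s - t)"
    if k: "k \<in> I" for k
  proof (cases "\<phi> k t = w t")
    case True
    obtain d where d: "d > 0" "\<And>s. s \<in> S \<Longrightarrow> \<bar>s - t\<bar> < d \<Longrightarrow>
        \<bar>\<phi> k s - \<phi> k t - D k * (s - t)\<bar> \<le> e * \<bar>s - t\<bar>" using approx[OF k] by blast
    have "\<phi> k s \<le> w t + (r + e) * (s - t)" if "s \<in> S" "t \<le> s" "s < t + d" for s
    proof -
      have "D k * (s - t) \<le> r * (s - t)"
        using active[OF k] True \<open>t \<le> s\<close> unfolding w_def by (intro mult_right_mono) auto
      then show ?thesis using d(2)[of s] that True by (auto simp: algebra_simps abs_le_iff)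
    qed
    then show ?thesis using d(1) by blast
  next
    case False
    then have neg: "\<phi> k t - w t - (r + e) * (t - t) < 0" using w_ge[OF k, of t] by auto
    have "continuous (at t within S) (\<lambda>s. \<phi> k s - w t - (r + e) * (s - t))"
      using DERIV_continuous[OF der[OF k]] by (intro continuous_intros)
    then have "((\<lambda>s. \<phi> k s - w t - (r + e) * (s - t)) \<longlongrightarrow> \<phi> k t - w t - (r + e) * (t - t)) (at t within S)"
      by (simp add: continuous_within)
    then have "\<forall>\<^sub>F s in at t within S. \<phi> k s - w t - (r + e) * (s - t) < 0"
      using neg by (rule order_tendstoD)
    then obtain d where "d > 0" "\<And>s. s \<in> S \<Longrightarrow> s \<noteq> t \<Longrightarrow> dist s t < d \<Longrightarrow>
        \<phi> k s - w t - (r + e) * (s - t) < 0"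
      unfolding eventually_at by blast
    then show ?thesis using neg by (intro exI[of _ d]) (fastforce simp: dist_real_def)
  qed
  then obtain d where d: "\<And>k. k \<in> I \<Longrightarrow> d k > 0"
      "\<And>k s. k \<in> I \<Longrightarrow> s \<in> S \<Longrightarrow> t \<le> s \<Longrightarrow> s < t + d k \<Longrightarrow> \<phi> k s \<le> w t + (r + e) * (s - t)"
    by metis
  obtain d0 where d0: "d0 > 0" "\<And>s. s \<in> S \<Longrightarrow> \<bar>s - t\<bar> < d0 \<Longrightarrow>
        \<bar>\<phi> k0 s - \<phi> k0 t - D k0 * (s - t)\<bar> \<le> e * \<bar>s - t\<bar>" using approx[OF k0(1)] by blast
  define d1 where "d1 = min d0 (Min (d ` I))"
  have d1: "d1 > 0" "d1 \<le> d0" "\<And>k. k \<in> I \<Longrightarrow> d1 \<le> d k"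
    using I d(1) d0(1) unfolding d1_def by (auto simp: min.coboundedI2)
  have "w v - w u \<le> (r + e) * (v - u)"
    if "u \<in> S" "v \<in> S" "u \<le> t" "t \<le> v" "t - d1 < u" "v < t + d1" for u v
  proof -
    have "w v \<in> (\<lambda>k. \<phi> k v) ` I" unfolding w_def using I by (intro Max_in) auto
    then have v: "w v \<le> w t + (r + e) * (v - t)"
      using d(2) d1(3) that by force
    have "D k0 * (t - u) \<le> r * (t - u)"
      using active[OF k0(1)] k0(2) \<open>u \<le> t\<close> unfolding w_def by (intro mult_right_mono) auto
    moreover have "\<bar>\<phi> k0 u - \<phi> k0 t - D k0 * (u - t)\<bar> \<le> e * \<bar>u - t\<bar>"
      using d0(2)[of u] d1(2) that by auto
    ultimately have "w t - (r + e) * (t - u) \<le> \<phi> k0 u"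
      using k0(2) \<open>u \<le> t\<close> by (auto simp: algebra_simps abs_le_iff)
    also have "\<dots> \<le> w u" using w_ge k0(1) .
    finally show ?thesis using v by (simp add: algebra_simps)
  qed
  then show "\<exists>d>0. \<forall>u\<in>S. \<forall>v\<in>S. u \<le> t \<and> t \<le> v \<and> t - d < u \<and> v < t + d \<longrightarrow>
      Max ((\<lambda>k. \<phi> k v) ` I) - Max ((\<lambda>k. \<phi> k u) ` I) \<le> (r + e) * (v - u)"
    using d1(1) unfolding w_def by blast
qed

lemma straddle_rate_le_deriv:
  assumes "(w has_real_derivative D) (at t within S)" "t \<in> S" "D \<le> r"
  shows "straddle_rate_le S w t r"
  using straddle_rate_le_Max[of "{()}" t S "\<lambda>_. w" "\<lambda>_. D" r] assms by simp

section \<open>Caratheodory solutions and dissipation\<close>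

text \<open>This is how all later estimates use the equation: a rate has to be checked only at times
  where the differential equation holds. The other times form a null set, and \<open>F\<close> being
  Lipschitz preserves absolute continuity.\<close>

lemma caratheodory_solution_increment_le:
  fixes F :: "'a::real_normed_vector \<Rightarrow> real"
  assumes sol: "caratheodory_solution \<Phi> S x" and F: "L-lipschitz_on S F"
    and ab: "0 \<le> a" "a \<le> b"
    and rate: "\<And>t. t \<in> {a..b} \<Longrightarrow> (x has_vector_derivative \<Phi> (x t)) (at t within {a..b})
      \<Longrightarrow> straddle_rate_le {a..b} (\<lambda>t. F (x t)) t r"
  shows "F (x b) - F (x a) \<le> r * (b - a)"
proof -
  have ac: "absolutely_continuous_on {a..b} x"
    using sol ab absolutely_continuous_on_subset[of "{0..b}" x "{a..b}"]
    unfolding caratheodory_solution_def by auto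
  have "x ` {a..b} \<subseteq> S" using sol ab unfolding caratheodory_solution_def by auto
  with ac F have ac': "absolutely_continuous_on {a..b} (\<lambda>t. F (x t))"
    by (rule absolutely_continuous_on_lipschitz_compose)
  have "AE t in lebesgue. t \<ge> 0 \<longrightarrow> (x has_vector_derivative \<Phi> (x t)) (at t within {0..})"
    using sol unfolding caratheodory_solution_def by blast
  then obtain N where N: "N \<in> null_sets lebesgue"
    and "{t \<in> space lebesgue. \<not> (t \<ge> 0 \<longrightarrow> (x has_vector_derivative \<Phi> (x t)) (at t within {0..}))} \<subseteq> N"
    unfolding eventually_ae_filter by blast
  then have der: "(x has_vector_derivative \<Phi> (x t)) (at t within {0..})" if "t \<ge> 0" "t \<notin> N" for t
    using that by auto
  show ?thesis
  proof (rule absolutely_continuous_on_increment_le[OF ac' ab(2)])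
    show "negligible N" using N negligible_iff_null_sets by blast
    fix t assume t: "t \<in> {a..b} - N"
    have "(x has_vector_derivative \<Phi> (x t)) (at t within {a..b})"
      using t ab by (intro has_vector_derivative_within_subset[OF der]) auto
    then show "straddle_rate_le {a..b} (\<lambda>t. F (x t)) t r" using rate t by blast
  qed
qed

text \<open>Testing against the increment \<open>e = x b - x a\<close> itself reduces the claim to a
  scalar function whose rate is at most \<open>K * norm e\<close>. The result later makes the
  dissipation uniformly continuous in time.\<close>

lemma caratheodory_solution_lipschitz:
  fixes x :: "real \<Rightarrow> 'a::real_inner"
  assumes sol: "caratheodory_solution \<Phi> S x" and K: "\<And>y. y \<in> S \<Longrightarrow> norm (\<Phi> y) \<le> K"
  shows "K-lipschitz_on {0..} x"
proof (rule lipschitz_on_leI)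
  have "x 0 \<in> S" using sol unfolding caratheodory_solution_def by auto
  then show "0 \<le> K" using K norm_ge_zero order_trans by blast
  fix a b :: real assume ab: "a \<in> {0..}" "b \<in> {0..}" "a \<le> b"
  define e where "e = x b - x a"
  have lip: "(norm e)-lipschitz_on S (\<lambda>y. y \<bullet> e)"
    using Cauchy_Schwarz_ineq2[of _ e]
    by (intro lipschitz_onI) (auto simp: dist_real_def dist_norm inner_diff_left[symmetric] mult.commute[of "norm e"])
  have "x b \<bullet> e - x a \<bullet> e \<le> K * norm e * (b - a)"
  proof (rule caratheodory_solution_increment_le[OF sol lip])
    fix t assume t: "t \<in> {a..b}" and der: "(x has_vector_derivative \<Phi> (x t)) (at t within {a..b})"
    have "((\<lambda>t. x t \<bullet> e) has_real_derivative \<Phi> (x t) \<bullet> e) (at t within {a..b})"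
      using bounded_linear.has_vector_derivative[OF bounded_linear_inner_left der, of e]
      by (simp add: has_real_derivative_iff_has_vector_derivative)
    moreover have "\<Phi> (x t) \<bullet> e \<le> K * norm e"
    proof -
      have "x t \<in> S" using sol t ab unfolding caratheodory_solution_def by auto
      then have "norm (\<Phi> (x t)) * norm e \<le> K * norm e" using K by (intro mult_right_mono) auto
      then show ?thesis using norm_cauchy_schwarz order_trans by blast
    qed
    ultimately show "straddle_rate_le {a..b} (\<lambda>t. x t \<bullet> e) t (K * norm e)"
      using t by (intro straddle_rate_le_deriv)
  qed (use ab in auto)
  moreover have "x b \<bullet> e - x a \<bullet> e = norm e * norm e"
    by (simp add: e_def inner_diff_left[symmetric] dot_square_norm power2_eq_square)
  ultimately have "norm e * norm e \<le> norm e * (K * (b - a))"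
    by (simp add: mult_ac)
  then have "norm e \<le> K * (b - a)"
    using \<open>0 \<le> K\<close> ab by (cases "norm e = 0") (auto simp: mult_le_cancel_left)
  then show "dist (x a) (x b) \<le> K * dist a b"
    using ab by (simp add: e_def dist_norm norm_minus_commute)
qed

section \<open>From decay rates to convergence\<close>

text \<open>A Barbalat-type argument: if \<open>k\<close> reaches \<open>\<eta>\<close> late,
  uniform continuity keeps it above \<open>\<eta> / 2\<close> for a fixed time, and \<open>y\<close>
  falls below its infimum. Constant lower bounds for \<open>k\<close> in \<open>decr\<close> stand
  in for its integral.\<close>

lemma dissipation_rate_tendsto_0:
  fixes y k :: "real \<Rightarrow> real"
  assumes uc: "uniformly_continuous_on {0..} k"
    and nonneg: "\<And>t. t \<ge> 0 \<Longrightarrow> k t \<ge> 0"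
    and bound: "\<And>t. t \<ge> 0 \<Longrightarrow> y t \<ge> m"
    and decr: "\<And>a b \<eta>. 0 \<le> a \<Longrightarrow> a \<le> b \<Longrightarrow> \<eta> \<ge> 0 \<Longrightarrow> (\<And>t. t \<in> {a..b} \<Longrightarrow> \<eta> \<le> k t)
      \<Longrightarrow> y b - y a \<le> - \<eta> * (b - a)"
  shows "(k \<longlongrightarrow> 0) at_top"
proof (rule tendstoI)
  fix \<eta> :: real assume \<eta>: "\<eta> > 0"
  then obtain d where d: "d > 0" "\<And>s t. s \<ge> 0 \<Longrightarrow> t \<ge> 0 \<Longrightarrow> dist s t < d \<Longrightarrow> dist (k s) (k t) < \<eta> / 2"
    using uc unfolding uniformly_continuous_on_def by (metis atLeast_iff half_gt_zero)
  define \<tau> where "\<tau> = d / 2"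
  have \<tau>: "\<tau> > 0" "\<tau> < d" using d(1) unfolding \<tau>_def by auto
  have bdd: "bdd_below (y ` {0..})" using bound by (auto intro: bdd_belowI[of _ m])
  \<comment> \<open>From \<open>t0\<close> on, \<open>y\<close> is closer to its infimum than the
    drop that one excursion of \<open>k\<close> to \<open>\<eta>\<close> would force.\<close>
  have "Inf (y ` {0..}) < Inf (y ` {0..}) + \<eta> / 2 * \<tau>" using \<eta> \<tau> by simp
  then obtain t0 where t0: "t0 \<ge> 0" "y t0 < Inf (y ` {0..}) + \<eta> / 2 * \<tau>"
    using cInf_lessD[of "y ` {0..}"] by force
  have "dist (k t) 0 < \<eta>" if t: "t \<ge> t0" for t
  proof (rule ccontr)
    assume "\<not> dist (k t) 0 < \<eta>"
    then have kt: "k t \<ge> \<eta>" using nonneg[of t] t t0(1) by (simp add: dist_real_def)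
    have "\<eta> / 2 \<le> k s" if "s \<in> {t..t + \<tau>}" for s
proof -
      have "dist (k s) (k t) < \<eta> / 2"
        using that \<tau> t t0(1) by (intro d(2)) (auto simp: dist_real_def)
      then show ?thesis using kt unfolding dist_real_def by linarith
    qed
    then have "y (t + \<tau>) - y t \<le> - (\<eta> / 2) * (t + \<tau> - t)"
      using \<eta> \<tau> t t0(1) by (intro decr) auto
    \<comment> \<open>The rate 0 in \<open>decr\<close> expresses that \<open>y\<close> is
      nonincreasing.\<close>
    moreover have "y t - y t0 \<le> - 0 * (t - t0)"
      using t t0(1) nonneg by (intro decr) auto
    moreover have "y (t + \<tau>) \<ge> Inf (y ` {0..})"
      using bdd t t0(1) \<tau> by (intro cInf_lower) auto
    ultimately show False using t0(2) by simp
  qed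
  then show "\<forall>\<^sub>F t in at_top. dist (k t) 0 < \<eta>"
    unfolding eventually_at_top_linorder by blast
qed

text \<open>On the compact part of \<open>S\<close> at distance at least \<open>e\<close> from
  \<open>X\<close>, \<open>h\<close> has a positive minimum; as soon as \<open>h (x t)\<close> is
  smaller, \<open>x t\<close> has left that part.\<close>

lemma infdist_tendsto_0_of_rate:
  fixes x :: "'b \<Rightarrow> 'a::heine_borel" and h :: "'a \<Rightarrow> real"
  assumes S: "compact S" and h: "continuous_on S h" "\<And>y. y \<in> S \<Longrightarrow> h y \<ge> 0"
    and zero: "\<And>y. y \<in> S \<Longrightarrow> h y = 0 \<Longrightarrow> y \<in> X"
    and x: "\<forall>\<^sub>F t in F. x t \<in> S" and lim: "((\<lambda>t. h (x t)) \<longlongrightarrow> 0) F"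
  shows "((\<lambda>t. infdist (x t) X) \<longlongrightarrow> 0) F"
proof (rule tendstoI)
  fix e :: real assume e: "e > 0"
  define T where "T = S \<inter> {y. e \<le> infdist y X}"
  have "closed {y. e \<le> infdist y X}"
    by (intro closed_Collect_le continuous_intros)
  then have T: "compact T" unfolding T_def using S by blast
  have "\<exists>m>0. \<forall>y\<in>T. m \<le> h y"
  proof (cases "T = {}")
    case False
    have "continuous_on T h" using h(1) T_def by (auto intro: continuous_on_subset)
    then obtain y0 where y0: "y0 \<in> T" "\<And>y. y \<in> T \<Longrightarrow> h y0 \<le> h y"
      using continuous_attains_inf[OF T False] by blast
    have "h y0 \<noteq> 0" using zero[of y0] y0(1) e unfolding T_def by auto
    then have "h y0 > 0" using h(2)[of y0] y0(1) unfolding T_def by auto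
    then show ?thesis using y0(2) by blast
  qed (auto intro: exI[of _ 1])
  then obtain m where m: "m > 0" "\<And>y. y \<in> T \<Longrightarrow> m \<le> h y" by blast
  have "\<forall>\<^sub>F t in F. h (x t) < m" using lim m(1) by (rule order_tendstoD)
  with x show "\<forall>\<^sub>F t in F. dist (infdist (x t) X) 0 < e"
  proof eventually_elim
    case (elim t)
    then have "x t \<notin> T" using m(2) by force
    then show ?case using elim infdist_nonneg[of "x t" X] unfolding T_def by auto
  qed
qed

section \<open>Separable costs and the graph Laplacian\<close>

lemma convex_on_deriv_ineq:
  fixes f :: "real \<Rightarrow> real"
  assumes "convex_on UNIV f" "f differentiable_on UNIV"
  shows "deriv f a * (b - a) \<le> f b - f a"
proof (rule convex_on_imp_above_tangent[OF assms(1)])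
  show "(f has_field_derivative deriv f a) (at a within UNIV)"
    using assms(2) by (simp add: DERIV_deriv_iff_real_differentiable differentiable_on_def)
qed auto

lemma convex_on_deriv_mono:
  fixes f :: "real \<Rightarrow> real"
  assumes "convex_on UNIV f" "f differentiable_on UNIV" "a \<le> b"
  shows "deriv f a \<le> deriv f b"
proof -
  have "(deriv f a - deriv f b) * (b - a) \<le> 0"
    using convex_on_deriv_ineq[OF assms(1,2), of a b] convex_on_deriv_ineq[OF assms(1,2), of b a]
    by (simp add: algebra_simps)
  then show ?thesis using assms(3) by (cases "a = b") (auto simp: mult_le_0_iff)
qed

text \<open>\<open>gradient\<close> is a definite description, so besides the coordinatewise
  candidate the uniqueness of the derivative is needed.\<close>

lemma gradient_total_cost:
  assumes "\<And>i. f i differentiable_on UNIV"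
  shows "gradient (total_cost f) x = (\<chi> i. deriv (f i) (x $ i))"
proof -
  have der: "(f i has_derivative (\<lambda>h. deriv (f i) y * h)) (at y)" for i y
    using assms[of i]
    by (metis DERIV_deriv_iff_real_differentiable UNIV_I differentiable_on_def has_field_derivative_def)
  have "((\<lambda>x. f i (x $ i)) has_derivative (\<lambda>h. deriv (f i) (x $ i) * h $ i)) (at x)" for i
    using has_derivative_compose[OF bounded_linear.has_derivative[OF bounded_linear_vec_nth[of i]
        has_derivative_ident] der[of i "x $ i"]] by simp
  then have "(total_cost f has_derivative (\<lambda>h. \<Sum>i\<in>UNIV. deriv (f i) (x $ i) * h $ i)) (at x)"
    unfolding total_cost_def[abs_def] by (intro has_derivative_sum)
  then have D: "GDERIV (total_cost f) x :> (\<chi> i. deriv (f i) (x $ i))"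
    unfolding gderiv_def by (simp add: inner_vec_def mult.commute)
  show ?thesis
    unfolding gradient_def
  proof (rule the_equality[of "\<lambda>D. GDERIV (total_cost f) x :> D", OF D])
    fix D' assume D': "GDERIV (total_cost f) x :> D'"
    have "(\<lambda>h. h \<bullet> D') = (\<lambda>h. h \<bullet> (\<chi> i. deriv (f i) (x $ i)))"
      using D D' unfolding gderiv_def by (rule has_derivative_unique[symmetric])
    then show "D' = (\<chi> i. deriv (f i) (x $ i))"
      by (metis vector_eq_ldot)
  qed
qed

section \<open>The graph Laplacian as a sum over arcs\<close>

lemma sum_neighbors_conv:
  fixes G :: "'n::finite pair_pre_digraph" and F :: "'n \<Rightarrow> real"
  shows "(\<Sum>j\<in>neighbors G i. F j) = (\<Sum>j\<in>UNIV. if (i, j) \<in> parcs G then F j else 0)"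
  unfolding neighbors_def by (subst sum.If_cases) (auto simp: Int_def)

lemma sum_neighbors_swap:
  fixes G :: "'n::finite pair_pre_digraph" and F :: "'n \<Rightarrow> 'n \<Rightarrow> real"
  assumes "sym (parcs G)"
  shows "(\<Sum>i\<in>UNIV. \<Sum>j\<in>neighbors G i. F i j) = (\<Sum>i\<in>UNIV. \<Sum>j\<in>neighbors G i. F j i)"
proof -
  have "(\<Sum>i\<in>UNIV. \<Sum>j\<in>neighbors G i. F i j)
      = (\<Sum>j\<in>UNIV. \<Sum>i\<in>UNIV. if (i, j) \<in> parcs G then F i j else 0)"
    unfolding sum_neighbors_conv by (rule sum.swap)
  also have "\<dots> = (\<Sum>j\<in>UNIV. \<Sum>i\<in>UNIV. if (j, i) \<in> parcs G then F i j else 0)"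
    using symD[OF assms] by (intro sum.cong refl) metis
  finally show ?thesis unfolding sum_neighbors_conv .
qed

lemma laplacian_mult_nth:
  fixes G :: "'n::finite pair_pre_digraph"
  assumes "\<And>i. (i, i) \<notin> parcs G"
  shows "(laplacian G *v q) $ i = (\<Sum>j\<in>neighbors G i. q $ i - q $ j)"
proof -
  have "(laplacian G *v q) $ i
      = (\<Sum>j\<in>UNIV. (if j = i then real (card (neighbors G i)) * q $ i else 0)
          - (if (i, j) \<in> parcs G then q $ j else 0))"
    unfolding matrix_vector_mult_def laplacian_def neighbors_def
    using assms by (auto intro!: sum.cong)
  also have "\<dots> = real (card (neighbors G i)) * q $ i - (\<Sum>j\<in>neighbors G i. q $ j)"
    unfolding sum_neighbors_conv by (simp add: sum_subtractf)
  finally show ?thesis by (simp add: sum_subtractf)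
qed

text \<open>Adding the sum to its copy with all arcs reversed turns \<open>q i * (q i - q j)\<close>
  into a square.\<close>

lemma laplacian_quadratic_form:
  fixes G :: "'n::finite pair_pre_digraph" and q :: "'n \<Rightarrow> real"
  assumes "sym (parcs G)"
  shows "(\<Sum>i\<in>UNIV. q i * (\<Sum>j\<in>neighbors G i. q i - q j))
    = (\<Sum>i\<in>UNIV. \<Sum>j\<in>neighbors G i. (q i - q j)\<^sup>2) / 2"
proof -
  have "(\<Sum>i\<in>UNIV. q i * (\<Sum>j\<in>neighbors G i. q i - q j))
      = (\<Sum>i\<in>UNIV. \<Sum>j\<in>neighbors G i. q i * (q i - q j))" (is "?S = ?S1")
    by (simp add: sum_distrib_left)
  moreover have "?S1 = (\<Sum>i\<in>UNIV. \<Sum>j\<in>neighbors G i. q j * (q j - q i))"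
    using sum_neighbors_swap[OF assms] .
  moreover have "?S1 + (\<Sum>i\<in>UNIV. \<Sum>j\<in>neighbors G i. q j * (q j - q i))
      = (\<Sum>i\<in>UNIV. \<Sum>j\<in>neighbors G i. (q i - q j)\<^sup>2)"
    unfolding sum.distrib[symmetric]
    by (intro sum.cong refl) (simp add: power2_eq_square algebra_simps)
  ultimately show ?thesis by simp
qed

text \<open>The edges inside \<open>A\<close> cancel, so only the cut edges remain.\<close>

lemma laplacian_cut:
  fixes G :: "'n::finite pair_pre_digraph" and q :: "'n \<Rightarrow> real"
  assumes "sym (parcs G)" and le: "\<And>i j. i \<in> A \<Longrightarrow> j \<notin> A \<Longrightarrow> q j \<le> q i"
  shows "(\<Sum>i\<in>A. \<Sum>j\<in>neighbors G i. q i - q j) \<ge> 0"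
proof -
  \<comment> \<open>With the indicator of \<open>A\<close> as weight, reversing the arcs yields the
    factor \<open>\<chi>A i - \<chi>A j\<close>. It vanishes unless the arc crosses the boundary of
    \<open>A\<close>, where \<open>le\<close> gives the sign.\<close>
  define \<chi>A where "\<chi>A = (\<lambda>i. if i \<in> A then 1 else 0 :: real)"
  have "(\<Sum>i\<in>A. \<Sum>j\<in>neighbors G i. q i - q j)
      = (\<Sum>i\<in>UNIV. if i \<in> A then \<Sum>j\<in>neighbors G i. q i - q j else 0)"
    by (simp add: sum.If_cases)
  also have "\<dots> = (\<Sum>i\<in>UNIV. \<Sum>j\<in>neighbors G i. \<chi>A i * (q i - q j))" (is "_ = ?S")
    unfolding \<chi>A_def by (intro sum.cong) auto
  finally have S: "(\<Sum>i\<in>A. \<Sum>j\<in>neighbors G i. q i - q j) = ?S" .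
  moreover have "?S = (\<Sum>i\<in>UNIV. \<Sum>j\<in>neighbors G i. \<chi>A j * (q j - q i))"
    using sum_neighbors_swap[OF assms(1)] .
  moreover have "?S + (\<Sum>i\<in>UNIV. \<Sum>j\<in>neighbors G i. \<chi>A j * (q j - q i))
      = (\<Sum>i\<in>UNIV. \<Sum>j\<in>neighbors G i. (\<chi>A i - \<chi>A j) * (q i - q j))"
    unfolding sum.distrib[symmetric] by (intro sum.cong refl) (simp add: algebra_simps)
  moreover have "(\<Sum>i\<in>UNIV. \<Sum>j\<in>neighbors G i. (\<chi>A i - \<chi>A j) * (q i - q j)) \<ge> 0"
    unfolding \<chi>A_def using le by (intro sum_nonneg) auto
  ultimately show ?thesis by linarith
qed

text \<open>Connectedness is reachability in the symmetrised digraph \<open>?H\<close>, so a walk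
  may use an arc of \<open>G\<close> in either direction; \<open>eq\<close> serves for both.\<close>

lemma connected_imp_constant:
  fixes G :: "'n pair_pre_digraph"
  assumes conn: "Digraph_Component.connected (with_proj G)" and V: "pverts G = UNIV"
    and eq: "\<And>i j. (i, j) \<in> parcs G \<Longrightarrow> q i = q j"
  shows "q i = q j"
proof -
  let ?H = "with_proj (mk_symmetric (with_proj G))"
  have "i \<rightarrow>\<^sup>*\<^bsub>?H\<^esub> j"
    using conn V unfolding connected_def strongly_connected_def by auto
  then have "(i, j) \<in> rtrancl_on (verts ?H) (arcs_ends ?H)" unfolding reachable_def .
  then show ?thesis
  proof (induction rule: rtrancl_on_induct)
    case (step y z)
    then show ?case using eq[of y z] eq[of z y] by (auto simp: parcs_mk_symmetric)
  qed simp
qed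

section \<open>The projected dynamics\<close>

locale regulated_network =
  fixes f :: "'n::finite \<Rightarrow> real \<Rightarrow> real"
    and lo hi :: "real ^ 'n"
    and G :: "'n pair_pre_digraph"
    and c g :: real
  assumes f_convex: "\<And>i. convex_on UNIV (f i)"
    and f_differentiable: "\<And>i. f i differentiable_on UNIV"
    and f_C1: "\<And>i. continuous_on UNIV (deriv (f i))"
    and Omega_compact: "compact (Omega lo hi)"
    and graph: "pair_graph G" "pverts G = UNIV"
    and graph_connected: "Digraph_Component.connected (with_proj G)"
    and c_pos: "c > 0"
begin

abbreviation f' :: "'n \<Rightarrow> real \<Rightarrow> real" where "f' i \<equiv> deriv (f i)"

abbreviation (input) imbalance :: "real ^ 'n \<Rightarrow> real" where
  "imbalance x \<equiv> g - (\<Sum>i\<in>UNIV. x $ i)"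

text \<open>The vector field before projection, with the Laplacian expanded into neighbor
  sums.\<close>

definition drift :: "real ^ 'n \<Rightarrow> 'n \<Rightarrow> real" where
  "drift x i = imbalance x - c * (\<Sum>j\<in>neighbors G i. f' i (x $ i) - f' j (x $ j))"

text \<open>The Laplacian quadratic form at the vector of derivatives; every edge occurs in both
  orientations, hence the division by 2.\<close>

definition disagreement :: "real ^ 'n \<Rightarrow> real" where
  "disagreement x = (\<Sum>i\<in>UNIV. \<Sum>j\<in>neighbors G i. (f' i (x $ i) - f' j (x $ j))\<^sup>2) / 2"

definition dissipation :: "real ^ 'n \<Rightarrow> real" where
  "dissipation x = c * disagreement x + \<bar>imbalance x\<bar>"

lemma sym_parcs: "sym (parcs G)"
proof -
  interpret pair_graph G by (rule graph)
  show ?thesis using pair_sym_arcs unfolding symmetric_def by simp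
qed

lemma no_loop: "(i, i) \<notin> parcs G"
proof -
  interpret pair_graph G by (rule graph)
  show ?thesis using pair_no_loops by fastforce
qed

lemma dynamics_nth:
  "dynamics f lo hi G c g x $ i =
     (if x $ i = lo $ i \<and> drift x i < 0 then 0
      else if x $ i = hi $ i \<and> drift x i > 0 then 0 else drift x i)"
proof -
  have "(- c *\<^sub>R (laplacian G *v gradient (total_cost f) x) + imbalance x *\<^sub>R 1) $ i = drift x i"
    unfolding gradient_total_cost[OF f_differentiable] drift_def
    by (simp add: laplacian_mult_nth[OF no_loop])
  then show ?thesis unfolding dynamics_def Gamma_def Let_def by simp
qed

lemma abs_dynamics_nth_le: "\<bar>dynamics f lo hi G c g x $ i\<bar> \<le> \<bar>drift x i\<bar>"
  unfolding dynamics_nth by auto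

lemma has_deriv: "(f i has_real_derivative f' i y) (at y)"
  using f_differentiable[of i] by (simp add: DERIV_deriv_iff_real_differentiable differentiable_on_def)

lemma continuous_f' [continuous_intros]:
  "continuous_on S h \<Longrightarrow> continuous_on S (\<lambda>x. f' i (h x))"
  using continuous_on_compose2[OF f_C1] by blast

lemma continuous_drift: "continuous_on S (\<lambda>x. drift x i)"
  unfolding drift_def by (intro continuous_intros)

lemma continuous_dissipation: "continuous_on S dissipation"
  unfolding dissipation_def[abs_def] disagreement_def by (intro continuous_intros) auto

lemma disagreement_nonneg: "disagreement x \<ge> 0"
  unfolding disagreement_def by (intro divide_nonneg_nonneg sum_nonneg) auto

lemma dissipation_nonneg: "dissipation x \<ge> 0"
  unfolding dissipation_def using disagreement_nonneg c_pos by simp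

lemma bounded_on_Omega:
  fixes h :: "real ^ 'n \<Rightarrow> real"
  assumes "continuous_on UNIV h"
  obtains B where "B \<ge> 0" "\<And>x. x \<in> Omega lo hi \<Longrightarrow> \<bar>h x\<bar> \<le> B"
proof -
  have "bounded (h ` Omega lo hi)"
    using assms Omega_compact
    by (intro compact_imp_bounded compact_continuous_image) (auto intro: continuous_on_subset)
  then obtain B where "\<And>x. x \<in> Omega lo hi \<Longrightarrow> \<bar>h x\<bar> \<le> B"
    unfolding bounded_iff by auto
  then show ?thesis by (intro that[of "\<bar>B\<bar>"]) force+
qed

text \<open>The projected field may be discontinuous, so compactness is applied to
  \<open>drift\<close>, which is continuous and dominates it in each coordinate.\<close>

lemma dynamics_bounded:
  obtains K where "\<And>x. x \<in> Omega lo hi \<Longrightarrow> norm (dynamics f lo hi G c g x) \<le> K"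
proof -
  have "continuous_on UNIV (\<lambda>x. \<Sum>i\<in>UNIV. \<bar>drift x i\<bar>)"
    by (intro continuous_intros continuous_drift)
  then obtain K where K: "\<And>x. x \<in> Omega lo hi \<Longrightarrow> \<bar>\<Sum>i\<in>UNIV. \<bar>drift x i\<bar>\<bar> \<le> K"
    using bounded_on_Omega by blast
  have "norm (dynamics f lo hi G c g x) \<le> K" if "x \<in> Omega lo hi" for x
  proof -
    have "norm (dynamics f lo hi G c g x) \<le> (\<Sum>i\<in>UNIV. \<bar>dynamics f lo hi G c g x $ i\<bar>)"
      by (rule norm_le_l1_cart)
    also have "\<dots> \<le> (\<Sum>i\<in>UNIV. \<bar>drift x i\<bar>)"
      by (intro sum_mono abs_dynamics_nth_le)
    finally show ?thesis using K[OF that] by linarith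
  qed
  then show ?thesis using that by blast
qed

section \<open>Optimality conditions\<close>

text \<open>The common derivative \<open>\<mu>\<close> is a Lagrange multiplier: summing the tangent
  inequalities, the linear terms cancel because both points have the same coordinate sum.\<close>

lemma optimizerI:
  assumes x: "x \<in> Omega lo hi" "(\<Sum>i\<in>UNIV. x $ i) = g" and eq: "\<And>i j. f' i (x $ i) = f' j (x $ j)"
  shows "x \<in> optimizers f lo hi g"
proof -
  have "total_cost f x \<le> total_cost f y" if "y \<in> feasible lo hi g" for y
  proof -
    obtain \<mu> where \<mu>: "\<And>i. f' i (x $ i) = \<mu>" using eq by metis
    have "0 = (\<Sum>i\<in>UNIV. \<mu> * (y $ i - x $ i))"
      using that x unfolding feasible_def
      by (simp add: sum_distrib_left[symmetric] sum_subtractf)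
    also have "\<dots> \<le> (\<Sum>i\<in>UNIV. f i (y $ i) - f i (x $ i))"
      using convex_on_deriv_ineq[OF f_convex f_differentiable] \<mu> by (intro sum_mono) metis
    finally show ?thesis unfolding total_cost_def by (simp add: sum_subtractf)
  qed
  then show ?thesis using x unfolding optimizers_def feasible_def by auto
qed

text \<open>Zero disagreement equalises the derivatives across every arc, and connectedness extends
  this to all pairs; zero imbalance is the constraint.\<close>

lemma dissipation_eq_0_imp_optimizer:
  assumes x: "x \<in> Omega lo hi" and zero: "dissipation x = 0"
  shows "x \<in> optimizers f lo hi g"
proof (rule optimizerI[OF x])
  have D: "disagreement x = 0" and u: "imbalance x = 0"
    using zero disagreement_nonneg[of x] c_pos unfolding dissipation_def
    by (auto simp: add_nonneg_eq_0_iff)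
  show "(\<Sum>i\<in>UNIV. x $ i) = g" using u by simp
  fix i j
  have "f' k (x $ k) = f' l (x $ l)" if "(k, l) \<in> parcs G" for k l
  proof -
    have "(\<Sum>j\<in>neighbors G k. (f' k (x $ k) - f' j (x $ j))\<^sup>2) = 0"
      using D unfolding disagreement_def by (simp add: sum_nonneg_eq_0_iff sum_nonneg)
    then show ?thesis using that by (simp add: sum_nonneg_eq_0_iff neighbors_def)
  qed
  then show "f' i (x $ i) = f' j (x $ j)"
    by (rule connected_imp_constant[OF graph_connected graph(2)])
qed

lemma interior_Omega:
  assumes "x \<in> interior (Omega lo hi)"
  shows "lo $ i < x $ i \<and> x $ i < hi $ i"
proof -
  obtain e where e: "e > 0" "cball x e \<subseteq> Omega lo hi"
    using assms unfolding mem_interior_cball by blast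
  have "x + s *\<^sub>R axis i 1 \<in> Omega lo hi" if "\<bar>s\<bar> \<le> e" for s
    using e(2) that by (intro subsetD[OF e(2)]) (simp add: dist_norm)
  then have "lo $ i \<le> (x + s *\<^sub>R axis i 1) $ i \<and> (x + s *\<^sub>R axis i 1) $ i \<le> hi $ i" if "\<bar>s\<bar> \<le> e" for s
    using that unfolding Omega_def mem_Collect_eq atLeastAtMost_iff by blast
  from this[of e] this[of "-e"] show ?thesis using e(1) by simp
qed

text \<open>First-order condition: exchanging mass between two coordinates keeps the sum.\<close>

lemma optimizer_deriv_eq:
  assumes x: "x \<in> optimizers f lo hi g" and int: "x \<in> interior (Omega lo hi)"
  shows "f' i (x $ i) = f' j (x $ j)"
proof (cases "i = j")
  case False
  obtain e where e: "e > 0" "cball x e \<subseteq> Omega lo hi"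
    using int unfolding mem_interior_cball by blast
  define p where "p = (\<lambda>s. x + s *\<^sub>R (axis i 1 - axis j 1 :: real ^ 'n))"
  define \<psi> where "\<psi> = (\<lambda>s. f i (x $ i + s) + f j (x $ j - s))"
  have p_nth: "p s $ k = (if k = i then x $ i + s else if k = j then x $ j - s else x $ k)" for s k
    using False unfolding p_def by (simp add: axis_def)
  \<comment> \<open>The direction of \<open>p\<close> has norm at most 2, so \<open>e / 2\<close>
    keeps \<open>p s\<close> in the box. The unchanged coordinates cancel in the cost comparison,
    which leaves \<open>\<psi>\<close>.\<close>
  have "\<psi> 0 \<le> \<psi> s" if "\<bar>0 - s\<bar> < e / 2" for s
  proof -
    have "norm (axis i 1 - axis j 1 :: real ^ 'n) \<le> 2"
      using norm_triangle_ineq4[of "axis i (1::real)" "axis j 1"] by simp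
    then have "\<bar>s\<bar> * norm (axis i 1 - axis j 1 :: real ^ 'n) \<le> e / 2 * 2"
      using that by (intro mult_mono) auto
    then have "p s \<in> Omega lo hi"
      by (intro subsetD[OF e(2)]) (simp add: p_def dist_norm)
    moreover have split: "(\<Sum>k\<in>UNIV. h k) = h i + h j + (\<Sum>k\<in>UNIV - {i} - {j}. h k)" for h :: "'n \<Rightarrow> real"
      using False by (simp add: sum.remove[of UNIV i] sum.remove[of "UNIV - {i}" j])
    have "(\<Sum>k\<in>UNIV. p s $ k) = (\<Sum>k\<in>UNIV. x $ k)"
      unfolding split[of "\<lambda>k. p s $ k"] split[of "\<lambda>k. x $ k"] using False by (auto simp: p_nth)
    ultimately have "p s \<in> feasible lo hi g"
      using x unfolding optimizers_def feasible_def by auto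
    then have "total_cost f x \<le> total_cost f (p s)"
      using x unfolding optimizers_def by auto
    then show ?thesis
      unfolding total_cost_def split[of "\<lambda>k. f k (p s $ k)"] split[of "\<lambda>k. f k (x $ k)"] \<psi>_def
      using False by (auto simp: p_nth)
  qed
  moreover have "(\<psi> has_real_derivative f' i (x $ i) - f' j (x $ j)) (at 0)"
  proof -
    have "((\<lambda>s. f i (x $ i + s)) has_real_derivative f' i (x $ i) * 1) (at 0)"
      by (rule DERIV_chain2[where g = "\<lambda>s. x $ i + s"])
        (use has_deriv[of i "x $ i"] in \<open>auto intro!: derivative_eq_intros\<close>)
    moreover have "((\<lambda>s. f j (x $ j - s)) has_real_derivative f' j (x $ j) * (- 1)) (at 0)"
      by (rule DERIV_chain2[where g = "\<lambda>s. x $ j - s"])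
        (use has_deriv[of j "x $ j"] in \<open>auto intro!: derivative_eq_intros\<close>)
    ultimately show ?thesis unfolding \<psi>_def using DERIV_add by fastforce
  qed
  ultimately have "f' i (x $ i) - f' j (x $ j) = 0"
    using e(1) by (intro DERIV_local_min[of \<psi> _ 0 "e / 2"]) auto
  then show ?thesis by simp
qed simp

end

section \<open>Lyapunov function around a fixed interior equilibrium\<close>

locale regulated_network_equilibrium = regulated_network f lo hi G c g
  for f :: "'n::finite \<Rightarrow> real \<Rightarrow> real" and lo hi G c g +
  fixes xs :: "real ^ 'n" and \<mu> :: real
  assumes xs_interior: "\<And>i. lo $ i < xs $ i" "\<And>i. xs $ i < hi $ i"
    and deriv_xs: "\<And>i. f' i (xs $ i) = \<mu>"
    and sum_xs: "(\<Sum>i\<in>UNIV. xs $ i) = g"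
begin

text \<open>Up to the constant \<open>bregman xs\<close>, this is the sum of the Bregman divergences
  of the \<open>f i\<close> between \<open>x\<close> and \<open>xs\<close>, since all derivatives at
  \<open>xs\<close> equal \<open>\<mu>\<close>.\<close>

definition bregman :: "real ^ 'n \<Rightarrow> real" where
  "bregman x = (\<Sum>i\<in>UNIV. f i (x $ i) - \<mu> * x $ i)"

definition signed_excess :: "real \<times> 'n set \<Rightarrow> real ^ 'n \<Rightarrow> real" where
  "signed_excess k x = fst k * (\<Sum>i\<in>snd k. x $ i - xs $ i)"

text \<open>The maximum of \<^term>\<open>signed_excess k x\<close> over \<open>k = (\<sigma>, A)\<close> is the larger of the sums of the
  positive and of the negative parts of \<open>x - xs\<close>.\<close>

definition lyapunov :: "real \<Rightarrow> real \<Rightarrow> real ^ 'n \<Rightarrow> real" where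
  "lyapunov a b x = Max ((\<lambda>k. a * bregman x + b * signed_excess k x) ` ({-1, 1} \<times> UNIV))"

lemma deriv_mono: "y \<le> z \<Longrightarrow> f' i y \<le> f' i z"
  by (rule convex_on_deriv_mono[OF f_convex f_differentiable])

lemma deriv_le: "y \<le> xs $ i \<Longrightarrow> f' i y \<le> \<mu>" and deriv_ge: "xs $ i \<le> y \<Longrightarrow> \<mu> \<le> f' i y"
  using deriv_mono[of y "xs $ i" i] deriv_mono[of "xs $ i" y i] deriv_xs[of i] by auto

text \<open>The projection removes only nonnegative terms \<open>q i * drift x i\<close>: at a lower
  end the removed drift is negative and, \<open>xs\<close> being interior, \<open>q i\<close> is at
  most 0; upper ends are symmetric. What remains is the Laplacian form and the imbalance times the
  sum of \<open>q\<close>.\<close>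

lemma bregman_dissipation:
  assumes B: "(\<Sum>i\<in>UNIV. \<bar>f' i (x $ i) - \<mu>\<bar>) \<le> B"
  shows "(\<Sum>i\<in>UNIV. (f' i (x $ i) - \<mu>) * dynamics f lo hi G c g x $ i)
    \<le> - c * disagreement x + B * \<bar>imbalance x\<bar>"
proof -
  define q where "q = (\<lambda>i. f' i (x $ i) - \<mu>)"
  have "q i * dynamics f lo hi G c g x $ i \<le> q i * drift x i" for i
    using deriv_le[of "x $ i" i] deriv_ge[of i "x $ i"] xs_interior[of i]
    unfolding dynamics_nth q_def by (auto simp: zero_le_mult_iff)
  then have "(\<Sum>i\<in>UNIV. q i * dynamics f lo hi G c g x $ i) \<le> (\<Sum>i\<in>UNIV. q i * drift x i)"
    by (intro sum_mono)
  also have "\<dots> = imbalance x * (\<Sum>i\<in>UNIV. q i)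
      - c * (\<Sum>i\<in>UNIV. q i * (\<Sum>j\<in>neighbors G i. q i - q j))"
  proof -
    have "q i * drift x i = imbalance x * q i - c * (q i * (\<Sum>j\<in>neighbors G i. q i - q j))" for i
      unfolding drift_def q_def by (simp add: algebra_simps)
    then show ?thesis by (simp add: sum_subtractf sum_distrib_left)
  qed
  also have "(\<Sum>i\<in>UNIV. q i * (\<Sum>j\<in>neighbors G i. q i - q j)) = disagreement x"
    unfolding laplacian_quadratic_form[OF sym_parcs] disagreement_def q_def by simp
  also have "imbalance x * (\<Sum>i\<in>UNIV. q i) \<le> B * \<bar>imbalance x\<bar>"
  proof -
    have "imbalance x * (\<Sum>i\<in>UNIV. q i) \<le> \<bar>imbalance x\<bar> * \<bar>\<Sum>i\<in>UNIV. q i\<bar>"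
      by (simp add: abs_mult[symmetric])
    moreover
    have "\<bar>\<Sum>i\<in>UNIV. q i\<bar> \<le> B"
      unfolding q_def using sum_abs B by (rule order_trans)
    then have "\<bar>imbalance x\<bar> * \<bar>\<Sum>i\<in>UNIV. q i\<bar> \<le> \<bar>imbalance x\<bar> * B"
      by (rule mult_left_mono) simp
    ultimately show ?thesis by (simp add: mult.commute)
  qed
  finally show ?thesis unfolding q_def by simp
qed

lemma sum_excess: "(\<Sum>i\<in>UNIV. x $ i - xs $ i) = - imbalance x"
  by (simp add: sum_subtractf sum_xs)

text \<open>The cut estimate shows that the consensus term does not increase the signed excess of
  \<open>A\<close>. Each coordinate of \<open>A\<close> then contributes at most
  \<open>\<sigma> * imbalance x = - \<bar>imbalance x\<bar>\<close>, and one such contribution is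
  enough.\<close>

lemma signed_excess_dissipation:
  assumes \<sigma>: "\<sigma> \<in> {-1, 1}"
    and inside: "\<And>i. i \<in> A \<Longrightarrow> \<sigma> * (x $ i - xs $ i) \<ge> 0"
    and outside: "\<And>i. i \<notin> A \<Longrightarrow> \<sigma> * (x $ i - xs $ i) \<le> 0"
    and u: "\<sigma> * imbalance x \<le> 0"
  shows "\<sigma> * (\<Sum>i\<in>A. dynamics f lo hi G c g x $ i) \<le> - \<bar>imbalance x\<bar>"
proof (cases "A = {}")
  \<comment> \<open>With no coordinate in \<open>A\<close>, \<open>outside\<close> forces the sign
    opposite to \<open>u\<close>, so the imbalance is 0.\<close>
  case True
  then have "(\<Sum>i\<in>UNIV. \<sigma> * (x $ i - xs $ i)) \<le> 0"
    using outside by (intro sum_nonpos) auto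
  then have "\<sigma> * - imbalance x \<le> 0"
    by (simp only: sum_distrib_left[symmetric] sum_excess)
  then have "\<sigma> * imbalance x \<ge> 0"
    by (simp only: mult_minus_right neg_le_0_iff_le)
  then have "imbalance x = 0" using u \<sigma> by auto
  then show ?thesis using True by simp
next
  case False
  define F where "F = (\<lambda>i. \<Sum>j\<in>neighbors G i. \<sigma> * f' i (x $ i) - \<sigma> * f' j (x $ j))"
  \<comment> \<open>A coordinate in \<open>A\<close> can touch the boundary only on the side of
    \<open>\<sigma>\<close>, where the projection replaces a drift of sign \<open>\<sigma>\<close>
    by 0.\<close>
  have le: "\<sigma> * dynamics f lo hi G c g x $ i \<le> \<sigma> * drift x i" if "i \<in> A" for i
    using inside[OF that] \<sigma> xs_interior[of i] unfolding dynamics_nth by auto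
  have "\<sigma> * (\<Sum>i\<in>A. dynamics f lo hi G c g x $ i) \<le> (\<Sum>i\<in>A. \<sigma> * drift x i)"
    unfolding sum_distrib_left using le by (rule sum_mono)
  also have "\<dots> = real (card A) * (\<sigma> * imbalance x) - c * (\<Sum>i\<in>A. F i)"
  proof -
    have "\<sigma> * drift x i = \<sigma> * imbalance x - c * F i" for i
      unfolding drift_def F_def right_diff_distrib[symmetric] sum_distrib_left[symmetric]
      by (simp add: algebra_simps)
    then show ?thesis by (simp add: sum_subtractf sum_distrib_left)
  qed
  also have "\<dots> \<le> real (card A) * (\<sigma> * imbalance x)"
  proof -
    have "(\<Sum>i\<in>A. F i) \<ge> 0"
      unfolding F_def
    proof (rule laplacian_cut[OF sym_parcs])
      fix i j assume i: "i \<in> A" and j: "j \<notin> A"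
      from \<sigma> consider "\<sigma> = 1" | "\<sigma> = -1" by blast
      then show "\<sigma> * f' j (x $ j) \<le> \<sigma> * f' i (x $ i)"
      proof cases
        case 1
        then have "f' j (x $ j) \<le> \<mu>" "\<mu> \<le> f' i (x $ i)"
          using inside[OF i] outside[OF j] by (simp_all add: deriv_le deriv_ge)
        then show ?thesis using 1 by simp
      next
        case 2
        then have "f' i (x $ i) \<le> \<mu>" "\<mu> \<le> f' j (x $ j)"
          using inside[OF i] outside[OF j] by (simp_all add: deriv_le deriv_ge)
        then show ?thesis using 2 by simp
      qed
    qed
    then show ?thesis using c_pos by simp
  qed
  also have "\<sigma> * imbalance x = - \<bar>imbalance x\<bar>" using \<sigma> u by auto
  also have "real (card A) * - \<bar>imbalance x\<bar> = - (real (card A) * \<bar>imbalance x\<bar>)" by simp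
  also have "\<dots> \<le> - (1 * \<bar>imbalance x\<bar>)"
  proof -
    have "card A \<ge> 1" using False by (simp add: Suc_leI card_gt_0_iff)
    then show ?thesis by (intro le_imp_neg_le mult_right_mono) auto
  qed
  finally show ?thesis by simp
qed

lemma signed_excess_le_lyapunov:
  assumes "k \<in> {-1, 1} \<times> UNIV"
  shows "a * bregman x + b * signed_excess k x \<le> lyapunov a b x"
  using assms unfolding lyapunov_def by (intro Max_ge) (auto simp: image_iff)

lemma lyapunov_attained:
  obtains k where "k \<in> {-1, 1} \<times> UNIV" "lyapunov a b x = a * bregman x + b * signed_excess k x"
proof -
  have "lyapunov a b x \<in> (\<lambda>k. a * bregman x + b * signed_excess k x) ` ({-1, 1} \<times> UNIV)"
    unfolding lyapunov_def by (intro Max_in) auto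
  then show ?thesis using that by auto
qed

text \<open>At a maximising pair \<open>(\<sigma>, A)\<close> the set \<open>A\<close> separates the coordinates by the sign of their
  excess, and the total excess has sign \<open>\<sigma>\<close>.\<close>

lemma maximal_signed_excess_dissipation:
  assumes b: "b > 0" and k: "k \<in> {-1, 1} \<times> UNIV"
    and max: "a * bregman x + b * signed_excess k x = lyapunov a b x"
  shows "fst k * (\<Sum>i\<in>snd k. dynamics f lo hi G c g x $ i) \<le> - \<bar>imbalance x\<bar>"
proof -
  obtain \<sigma> A where k_def: "k = (\<sigma>, A)" by (cases k)
  have \<sigma>: "\<sigma> \<in> {-1, 1}" using k k_def by auto
  have le: "signed_excess (\<sigma>', A') x \<le> signed_excess (\<sigma>, A) x" if "\<sigma>' \<in> {-1, 1}" for \<sigma>' A'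
  proof -
    have "b * signed_excess (\<sigma>', A') x \<le> b * signed_excess (\<sigma>, A) x"
      using signed_excess_le_lyapunov[of "(\<sigma>', A')" a x b] that max unfolding k_def by auto
    then show ?thesis using b by simp
  qed
  have "\<sigma> * (\<Sum>i\<in>A. dynamics f lo hi G c g x $ i) \<le> - \<bar>imbalance x\<bar>"
  proof (rule signed_excess_dissipation[OF \<sigma>])
    \<comment> \<open>The maximal pair is compared with three competitors: \<open>A\<close> without
      \<open>i\<close>, \<open>A\<close> with \<open>i\<close> added, and the complement of
      \<open>A\<close> under the opposite sign.\<close>
    show "\<sigma> * (x $ i - xs $ i) \<ge> 0" if "i \<in> A" for i
      using le[OF \<sigma>, of "A - {i}"] that unfolding signed_excess_def
      by (simp add: sum_diff1 right_diff_distrib)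
    show "\<sigma> * (x $ i - xs $ i) \<le> 0" if "i \<notin> A" for i
      using le[OF \<sigma>, of "insert i A"] that unfolding signed_excess_def
      by (simp add: distrib_left)
    have "(\<Sum>i\<in>- A. x $ i - xs $ i) = - imbalance x - (\<Sum>i\<in>A. x $ i - xs $ i)"
      using sum.subset_diff[of A UNIV "\<lambda>i. x $ i - xs $ i"] sum_excess[of x] by (simp add: Compl_eq_Diff_UNIV)
    then show "\<sigma> * imbalance x \<le> 0"
      using le[of "- \<sigma>" "- A"] \<sigma> unfolding signed_excess_def fst_conv snd_conv
      by (auto simp: algebra_simps)
  qed
  then show ?thesis unfolding k_def by simp
qed

section \<open>Rates and Lipschitz bounds for the Lyapunov function\<close>

lemma bregman_deriv:
  assumes "(x has_vector_derivative v) (at t within T)"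
  shows "((\<lambda>t. bregman (x t)) has_real_derivative (\<Sum>i\<in>UNIV. (f' i (x t $ i) - \<mu>) * v $ i)) (at t within T)"
proof -
  have nth: "((\<lambda>t. x t $ i) has_real_derivative v $ i) (at t within T)" for i
    using bounded_linear.has_vector_derivative[OF bounded_linear_vec_nth assms, of i]
    by (simp add: has_real_derivative_iff_has_vector_derivative)
  show ?thesis
    unfolding bregman_def left_diff_distrib
    by (intro DERIV_sum DERIV_diff DERIV_cmult nth DERIV_chain2[OF has_deriv])
qed

lemma signed_excess_deriv:
  assumes "(x has_vector_derivative v) (at t within T)"
  shows "((\<lambda>t. signed_excess k (x t)) has_real_derivative fst k * (\<Sum>i\<in>snd k. v $ i)) (at t within T)"
proof -
  have nth: "((\<lambda>t. x t $ i) has_real_derivative v $ i) (at t within T)" for i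
    using bounded_linear.has_vector_derivative[OF bounded_linear_vec_nth assms, of i]
    by (simp add: has_real_derivative_iff_has_vector_derivative)
  have "((\<lambda>t. x t $ i - xs $ i) has_real_derivative v $ i) (at t within T)" for i
    using DERIV_diff[OF nth DERIV_const] by simp
  then show ?thesis
    unfolding signed_excess_def by (intro DERIV_cmult DERIV_sum)
qed

text \<open>Only active branches of the maximum matter. There the excess part gains
  \<open>b * \<bar>imbalance (x t)\<bar>\<close>, while the Bregman part loses at most
  \<open>a * B * \<bar>imbalance (x t)\<bar>\<close> and gains the disagreement.\<close>

lemma lyapunov_rate:
  assumes t: "t \<in> T" and der: "(x has_vector_derivative dynamics f lo hi G c g (x t)) (at t within T)"
    and a: "a \<ge> 0" and b: "b > 0"
    and B: "(\<Sum>i\<in>UNIV. \<bar>f' i (x t $ i) - \<mu>\<bar>) \<le> B"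
  shows "straddle_rate_le T (\<lambda>t. lyapunov a b (x t)) t
    (- (a * c * disagreement (x t)) - (b - a * B) * \<bar>imbalance (x t)\<bar>)"
proof -
  let ?v = "dynamics f lo hi G c g (x t)"
  let ?D = "\<lambda>k. a * (\<Sum>i\<in>UNIV. (f' i (x t $ i) - \<mu>) * ?v $ i) + b * (fst k * (\<Sum>i\<in>snd k. ?v $ i))"
  show ?thesis
    unfolding lyapunov_def
  proof (rule straddle_rate_le_Max[where D = ?D])
    show "((\<lambda>t. a * bregman (x t) + b * signed_excess k (x t)) has_real_derivative ?D k) (at t within T)" for k
      by (intro DERIV_add DERIV_cmult bregman_deriv signed_excess_deriv der)
    fix k assume k: "k \<in> {-1, 1} \<times> (UNIV :: 'n set set)"
      and "a * bregman (x t) + b * signed_excess k (x t)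
        = Max ((\<lambda>k. a * bregman (x t) + b * signed_excess k (x t)) ` ({-1, 1} \<times> UNIV))"
    then have "fst k * (\<Sum>i\<in>snd k. ?v $ i) \<le> - \<bar>imbalance (x t)\<bar>"
      using maximal_signed_excess_dissipation[OF b k, of a "x t"] unfolding lyapunov_def by blast
    then have "b * (fst k * (\<Sum>i\<in>snd k. ?v $ i)) \<le> b * (- \<bar>imbalance (x t)\<bar>)"
      using b by (intro mult_left_mono) auto
    moreover have "a * (\<Sum>i\<in>UNIV. (f' i (x t $ i) - \<mu>) * ?v $ i)
        \<le> a * (- c * disagreement (x t) + B * \<bar>imbalance (x t)\<bar>)"
      using bregman_dissipation[OF B] a by (intro mult_left_mono)
    ultimately show "?D k \<le> - (a * c * disagreement (x t)) - (b - a * B) * \<bar>imbalance (x t)\<bar>"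
      by (simp add: algebra_simps)
  qed (use t in auto)
qed

lemma lyapunov_ge: "a * bregman x \<le> lyapunov a b x"
  using signed_excess_le_lyapunov[of "(1, {})" a x b] by (simp add: signed_excess_def)

lemma bregman_ge: "bregman xs \<le> bregman x"
  unfolding bregman_def
proof (rule sum_mono)
  fix i
  show "f i (xs $ i) - \<mu> * xs $ i \<le> f i (x $ i) - \<mu> * x $ i"
    using convex_on_deriv_ineq[OF f_convex f_differentiable, of i "xs $ i" "x $ i"] deriv_xs[of i]
    by (simp add: algebra_simps)
qed

lemma signed_excess_diff_le:
  assumes "k \<in> {-1, 1} \<times> UNIV"
  shows "signed_excess k x - signed_excess k y \<le> real CARD('n) * norm (x - y)"
proof -
  obtain \<sigma> A where k: "k = (\<sigma>, A)" "\<sigma> \<in> {-1, 1}" using assms by auto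
  have "signed_excess k x - signed_excess k y = (\<Sum>i\<in>A. \<sigma> * (x - y) $ i)"
    unfolding signed_excess_def k fst_conv snd_conv right_diff_distrib[symmetric] sum_subtractf[symmetric]
    by (simp add: sum_distrib_left)
  also have "\<dots> \<le> (\<Sum>i\<in>A. norm (x - y))"
  proof (rule sum_mono)
    fix i show "\<sigma> * (x - y) $ i \<le> norm (x - y)"
      using component_le_norm_cart[of "x - y" i] k(2) by auto
  qed
  also have "\<dots> = real (card A) * norm (x - y)" by simp
  also have "\<dots> \<le> real CARD('n) * norm (x - y)"
    by (intro mult_right_mono) (auto intro: card_mono)
  finally show ?thesis .
qed

text \<open>The mean value bound applies in each coordinate, as the continuous derivatives are
  bounded on compact intervals. Lipschitz continuity makes the Lyapunov function absolutely
  continuous along solutions.\<close>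

lemma bregman_lipschitz:
  obtains L where "L-lipschitz_on (Omega lo hi) bregman"
proof -
  have "\<exists>M. M \<ge> 0 \<and> (\<forall>y\<in>{lo $ i..hi $ i}. \<bar>f' i y - \<mu>\<bar> \<le> M)" for i
  proof -
    have "bounded ((\<lambda>y. f' i y - \<mu>) ` {lo $ i..hi $ i})"
      by (intro compact_imp_bounded compact_continuous_image continuous_intros) auto
    then obtain M where "\<forall>y\<in>{lo $ i..hi $ i}. \<bar>f' i y - \<mu>\<bar> \<le> M"
      unfolding bounded_iff by auto
    then show ?thesis by (intro exI[of _ "\<bar>M\<bar>"]) force
  qed
  then obtain M where M: "\<And>i. M i \<ge> 0" "\<And>i y. y \<in> {lo $ i..hi $ i} \<Longrightarrow> \<bar>f' i y - \<mu>\<bar> \<le> M i"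
    by metis
  have "(\<Sum>i\<in>UNIV. M i)-lipschitz_on (Omega lo hi) bregman"
  proof (rule lipschitz_onI)
    show "0 \<le> (\<Sum>i\<in>UNIV. M i)" using M(1) by (simp add: sum_nonneg)
    fix x y assume xy: "x \<in> Omega lo hi" "y \<in> Omega lo hi"
    have le: "\<bar>(f i (x $ i) - \<mu> * x $ i) - (f i (y $ i) - \<mu> * y $ i)\<bar> \<le> M i * dist x y" for i
    proof -
      have "norm ((f i (x $ i) - \<mu> * x $ i) - (f i (y $ i) - \<mu> * y $ i)) \<le> M i * norm (x $ i - y $ i)"
      proof (rule field_differentiable_bound[of "{lo $ i..hi $ i}"])
        show "((\<lambda>z. f i z - \<mu> * z) has_real_derivative f' i z - \<mu>) (at z within {lo $ i..hi $ i})" for z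
          by (intro has_field_derivative_at_within[OF DERIV_diff] has_deriv DERIV_cmult_Id)
      qed (use M(2) xy in \<open>auto simp: Omega_def\<close>)
      also have "\<dots> \<le> M i * dist x y"
        using M(1)[of i] component_le_norm_cart[of "x - y" i] by (intro mult_left_mono) (auto simp: dist_norm)
      finally show ?thesis by simp
    qed
    have "dist (bregman x) (bregman y)
        \<le> (\<Sum>i\<in>UNIV. \<bar>(f i (x $ i) - \<mu> * x $ i) - (f i (y $ i) - \<mu> * y $ i)\<bar>)"
      unfolding bregman_def dist_real_def sum_subtractf[symmetric] by (rule sum_abs)
    also have "\<dots> \<le> (\<Sum>i\<in>UNIV. M i) * dist x y"
      unfolding sum_distrib_right by (intro sum_mono le)
    finally show "dist (bregman x) (bregman y) \<le> (\<Sum>i\<in>UNIV. M i) * dist x y" .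
  qed
  then show ?thesis using that by blast
qed

text \<open>The branch attaining the maximum at \<open>x\<close> is a lower bound for the maximum at
  \<open>y\<close>, so the bounds for the branches pass to the maximum.\<close>

lemma lyapunov_lipschitz:
  assumes a: "a \<ge> 0" and b: "b \<ge> 0"
  obtains L where "L-lipschitz_on (Omega lo hi) (lyapunov a b)"
proof -
  obtain M where M: "M-lipschitz_on (Omega lo hi) bregman" by (rule bregman_lipschitz)
  define L where "L = a * M + b * real CARD('n)"
  have M0: "M \<ge> 0" using M by (rule lipschitz_on_nonneg)
  have diff: "lyapunov a b x - lyapunov a b y \<le> L * dist x y"
    if xy: "x \<in> Omega lo hi" "y \<in> Omega lo hi" for x y
  proof -
    obtain k where k: "k \<in> {-1, 1} \<times> UNIV" "lyapunov a b x = a * bregman x + b * signed_excess k x"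
      by (rule lyapunov_attained)
    have "a * (bregman x - bregman y) \<le> a * (M * dist x y)"
      using lipschitz_onD[OF M xy] a by (intro mult_left_mono) (auto simp: dist_real_def)
    moreover have "b * (signed_excess k x - signed_excess k y) \<le> b * (real CARD('n) * dist x y)"
      using signed_excess_diff_le[OF k(1)] b by (intro mult_left_mono) (auto simp: dist_norm)
    ultimately show ?thesis
      using k(2) signed_excess_le_lyapunov[OF k(1), of a y b] unfolding L_def by (simp add: algebra_simps)
  qed
  have "L-lipschitz_on (Omega lo hi) (lyapunov a b)"
  proof (rule lipschitz_onI)
    fix x y assume "x \<in> Omega lo hi" "y \<in> Omega lo hi"
    then show "dist (lyapunov a b x) (lyapunov a b y) \<le> L * dist x y"
      using diff[of x y] diff[of y x] by (simp add: dist_real_def abs_le_iff dist_commute)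
  qed (use a b M0 in \<open>auto simp: L_def\<close>)
  then show ?thesis using that by blast
qed

section \<open>Stability estimate and decay of the dissipation\<close>

abbreviation solution :: "(real \<Rightarrow> real ^ 'n) \<Rightarrow> bool" where
  "solution x \<equiv> caratheodory_solution (dynamics f lo hi G c g) (Omega lo hi) x"

text \<open>\<open>lyapunov 0 1\<close> does not increase along solutions, dominates every
  coordinate of \<open>x - xs\<close> through singleton sets, and is initially at most
  \<open>CARD('n)\<close> times the distance. Summing over the coordinates gives the second factor
  \<open>CARD('n)\<close>.\<close>

lemma solution_dist_le:
  assumes sol: "solution x" and t: "t \<ge> 0"
  shows "dist (x t) xs \<le> (real CARD('n))\<^sup>2 * dist (x 0) xs"
proof -
  obtain L where L: "L-lipschitz_on (Omega lo hi) (lyapunov 0 1)"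
    using lyapunov_lipschitz[of 0 1] by auto
  have "lyapunov 0 1 (x t) - lyapunov 0 1 (x 0) \<le> 0 * (t - 0)"
  proof (rule caratheodory_solution_increment_le[OF sol L])
    fix s assume s: "s \<in> {0..t}"
      and der: "(x has_vector_derivative dynamics f lo hi G c g (x s)) (at s within {0..t})"
    show "straddle_rate_le {0..t} (\<lambda>t. lyapunov 0 1 (x t)) s 0"
      by (rule straddle_rate_le_mono[OF lyapunov_rate[OF s der]]) auto
  qed (use t in auto)
  moreover obtain k where "k \<in> {-1, 1} \<times> UNIV" "lyapunov 0 1 (x 0) = 0 * bregman (x 0) + 1 * signed_excess k (x 0)"
    by (rule lyapunov_attained)
  moreover from this have "signed_excess k (x 0) \<le> real CARD('n) * dist (x 0) xs"
    using signed_excess_diff_le[of k "x 0" xs] by (simp add: signed_excess_def dist_norm)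
  ultimately have ub: "lyapunov 0 1 (x t) \<le> real CARD('n) * dist (x 0) xs" by simp
  have "\<bar>x t $ i - xs $ i\<bar> \<le> lyapunov 0 1 (x t)" for i
    using signed_excess_le_lyapunov[of "(1, {i})" 0 "x t" 1] signed_excess_le_lyapunov[of "(-1, {i})" 0 "x t" 1]
    by (simp add: signed_excess_def)
  then have "(\<Sum>i\<in>UNIV. \<bar>(x t - xs) $ i\<bar>) \<le> (\<Sum>i\<in>(UNIV :: 'n set). real CARD('n) * dist (x 0) xs)"
    using ub by (intro sum_mono) (simp add: order_trans[OF _ ub])
  then show ?thesis
    using norm_le_l1_cart[of "x t - xs"] by (simp add: dist_norm power2_eq_square mult.assoc)
qed

text \<open>The weights \<open>1\<close> and \<open>B + 1\<close> leave the coefficient 1 on the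
  imbalance, so the rate of \<open>lyapunov 1 (B + 1)\<close> is at most
  \<open>- dissipation\<close>. Uniform continuity in time comes from the Lipschitz solution and the
  compact box.\<close>

lemma solution_dissipation_tendsto_0:
  assumes sol: "solution x"
  shows "((\<lambda>t. dissipation (x t)) \<longlongrightarrow> 0) at_top"
proof -
  have x_in: "x t \<in> Omega lo hi" if "t \<ge> 0" for t
    using sol that unfolding caratheodory_solution_def by blast
  have "continuous_on UNIV (\<lambda>x. \<Sum>i\<in>UNIV. \<bar>f' i (x $ i) - \<mu>\<bar>)"
    by (intro continuous_intros)
  then obtain B where B: "B \<ge> 0"
    and B': "\<And>x. x \<in> Omega lo hi \<Longrightarrow> \<bar>\<Sum>i\<in>UNIV. \<bar>f' i (x $ i) - \<mu>\<bar>\<bar> \<le> B"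
    using bounded_on_Omega by blast
  have B': "(\<Sum>i\<in>UNIV. \<bar>f' i (x t $ i) - \<mu>\<bar>) \<le> B" if "t \<ge> 0" for t
    using B'[OF x_in[OF that]] by linarith
  obtain L where L: "L-lipschitz_on (Omega lo hi) (lyapunov 1 (B + 1))"
    using lyapunov_lipschitz[of 1 "B + 1"] B by auto
  obtain K where K: "\<And>x. x \<in> Omega lo hi \<Longrightarrow> norm (dynamics f lo hi G c g x) \<le> K"
    using dynamics_bounded by blast
  have "K-lipschitz_on {0..} x" using sol K by (rule caratheodory_solution_lipschitz)
  then have ucx: "uniformly_continuous_on {0..} x" by (rule lipschitz_on_uniformly_continuous)
  have "uniformly_continuous_on (Omega lo hi) dissipation"
    using continuous_dissipation Omega_compact by (rule compact_uniformly_continuous)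
  moreover have "x ` {0..} \<subseteq> Omega lo hi" using x_in by auto
  ultimately have "uniformly_continuous_on (x ` {0..}) dissipation"
    unfolding uniformly_continuous_on_def by (meson subset_iff)
  with ucx have uc: "uniformly_continuous_on {0..} (\<lambda>t. dissipation (x t))"
    by (rule uniformly_continuous_on_compose[unfolded o_def])
  show ?thesis
  proof (rule dissipation_rate_tendsto_0[OF uc, where y = "\<lambda>t. lyapunov 1 (B + 1) (x t)" and m = "bregman xs"])
    show "dissipation (x t) \<ge> 0" for t by (rule dissipation_nonneg)
    show "bregman xs \<le> lyapunov 1 (B + 1) (x t)" for t
      using bregman_ge[of "x t"] lyapunov_ge[of 1 "x t" "B + 1"] by simp
    fix a b \<eta> :: real
    assume ab: "0 \<le> a" "a \<le> b" and \<eta>: "\<And>t. t \<in> {a..b} \<Longrightarrow> \<eta> \<le> dissipation (x t)"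
    show "lyapunov 1 (B + 1) (x b) - lyapunov 1 (B + 1) (x a) \<le> - \<eta> * (b - a)"
    proof (rule caratheodory_solution_increment_le[OF sol L ab])
      fix s assume s: "s \<in> {a..b}"
        and der: "(x has_vector_derivative dynamics f lo hi G c g (x s)) (at s within {a..b})"
      have "s \<ge> 0" using s ab by auto
      show "straddle_rate_le {a..b} (\<lambda>t. lyapunov 1 (B + 1) (x t)) s (- \<eta>)"
        by (rule straddle_rate_le_mono[OF lyapunov_rate[OF s der _ _ B'[OF \<open>s \<ge> 0\<close>]]])
          (use B \<eta>[OF s] in \<open>auto simp: dissipation_def\<close>)
    qed
  qed
qed

end

theorem lemma4p8:
  fixes f :: "'n::finite \<Rightarrow> real \<Rightarrow> real"
    and lo hi :: "real ^ 'n"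
    and G :: "'n pair_pre_digraph"
    and c g :: real
  assumes f_convex: "\<And>i. convex_on UNIV (f i)"
    and f_min: "\<And>i x. f i 0 \<le> f i x"
    and f_coercive: "\<And>i (F::real). F \<ge> 0 \<Longrightarrow> compact {x. f i x \<le> F}"
    and f_differentiable: "\<And>i. f i differentiable_on UNIV"
    and f_C1: "\<And>i. continuous_on UNIV (deriv (f i))"
    and f_lipschitz: "\<And>i. \<exists>C. C-lipschitz_on UNIV (deriv (f i))"
    and intervals: "\<And>i. lo $ i \<le> hi $ i"
    and Omega_compact: "compact (Omega lo hi)"
    and graph: "pair_graph G" "pverts G = UNIV"
    and graph_connected: "Digraph_Component.connected (with_proj G)"
    and c_pos: "c > 0"
    and solvable: "optimizers f lo hi g \<noteq> {}"
    and strictly_feasible: "optimizers f lo hi g \<subseteq> interior (Omega lo hi)"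
  shows "globally_asymptotically_stable (dynamics f lo hi G c g) (Omega lo hi) (optimizers f lo hi g)"
proof -
  let ?X = "optimizers f lo hi g" and ?S = "Omega lo hi" and ?\<Phi> = "dynamics f lo hi G c g"
  let ?n = "real CARD('n)"
  interpret regulated_network f lo hi G c g
    by (rule regulated_network.intro) (fact assms)+
  have equilibrium: "\<exists>\<mu>. regulated_network_equilibrium f lo hi G c g xs \<mu>" if xs: "xs \<in> ?X" for xs
  proof -
    have int: "xs \<in> interior ?S" using xs strictly_feasible by blast
    obtain \<mu> where \<mu>: "\<And>i. f' i (xs $ i) = \<mu>" using optimizer_deriv_eq[OF xs int] by metis
    have "(\<Sum>i\<in>UNIV. xs $ i) = g" using xs unfolding optimizers_def feasible_def by auto
    then show ?thesis using interior_Omega[OF int] \<mu> by (intro exI[of _ \<mu>] , unfold_locales) auto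
  qed
  show ?thesis
    unfolding globally_asymptotically_stable_def
  proof (intro conjI allI impI)
    fix e :: real assume e: "e > 0"
    have stable: "infdist (x t) ?X < e"
      if sol: "caratheodory_solution ?\<Phi> ?S x" and init: "infdist (x 0) ?X < e / ?n\<^sup>2" and t: "t \<ge> 0" for x t
    proof -
      \<comment> \<open>The optimizer near \<open>x 0\<close> depends on the solution, but the
        factor \<open>?n\<^sup>2\<close> does not, so one \<delta> serves for all solutions.\<close>
      obtain xs where xs: "xs \<in> ?X" "dist (x 0) xs < e / ?n\<^sup>2"
        using init solvable by (auto simp: infdist_notempty cINF_less_iff)
      then interpret regulated_network_equilibrium f lo hi G c g xs "SOME \<mu>. regulated_network_equilibrium f lo hi G c g xs \<mu>"
        using equilibrium by (metis someI_ex)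
      have "infdist (x t) ?X \<le> dist (x t) xs" using xs(1) by (rule infdist_le)
      also have "\<dots> \<le> ?n\<^sup>2 * dist (x 0) xs" using sol t by (rule solution_dist_le)
      also have "\<dots> < ?n\<^sup>2 * (e / ?n\<^sup>2)" using xs(2) by (intro mult_strict_left_mono) auto
      finally show ?thesis by simp
    qed
    show "\<exists>\<delta>>0. \<forall>x. caratheodory_solution ?\<Phi> ?S x \<and> x 0 \<in> ?S \<and> infdist (x 0) ?X < \<delta>
        \<longrightarrow> (\<forall>t\<ge>0. infdist (x t) ?X < e)"
      using stable e by (intro exI[of _ "e / ?n\<^sup>2"]) auto
  next
    fix x assume x: "caratheodory_solution ?\<Phi> ?S x \<and> x 0 \<in> ?S"
    \<comment> \<open>Any optimizer serves as reference point here, because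
      \<open>dissipation\<close> does not depend on it.\<close>
    obtain xs \<mu> where "regulated_network_equilibrium f lo hi G c g xs \<mu>"
      using solvable equilibrium by blast
    then interpret regulated_network_equilibrium f lo hi G c g xs \<mu> .
    show "((\<lambda>t. infdist (x t) ?X) \<longlongrightarrow> 0) at_top"
    proof (rule infdist_tendsto_0_of_rate[OF Omega_compact continuous_dissipation])
      show "\<forall>\<^sub>F t in at_top. x t \<in> ?S"
        using x unfolding caratheodory_solution_def eventually_at_top_linorder by blast
      show "((\<lambda>t. dissipation (x t)) \<longlongrightarrow> 0) at_top"
        using x solution_dissipation_tendsto_0 by blast
    qed (use dissipation_nonneg dissipation_eq_0_imp_optimizer in auto)
  qed
qed

end
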